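(* Let $\phi:[0,1]\to[0,1]$ be a nondecreasing continuous function such that $\phi(x)>x$ for all $x\in(0,1)$, and let $V_\phi$ be the operator on $L_2[0,1]$ defined by $(V_\phi f)(x)=\int_0^{\phi(x)}f(t)\,dt$. Write $\sigma_p(V_\phi)\setminus\{0\}=\{\lambda_n\}_{n=1}^{\omega}$ with $1\le\omega\le\infty$. Then: (1) $\omega<\infty$ if and only if $\phi(0)>0$ and $\phi(1-\varepsilon)=1$ for some $0<\varepsilon<1$; (2) $\lim_{\varepsilon\to 0}\sum_{|\lambda_n|>\varepsilon}\lambda_n=1$; (3) $\sum_{n=1}^{\omega}|\lambda_n|^{1+\varepsilon}<\infty$ for all $\varepsilon>0$.
   Context: $\sigma_p(V_\phi)$ denotes the point spectrum (set of eigenvalues) of $V_\phi$. The nonzero eigenvalues $\lambda_n$ are listed repeated according to their algebraic multiplicities. *)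

theory Defs
  imports "HOL-Analysis.Analysis"
begin

definition L2_01 :: "(real \<Rightarrow> complex) set" where
  "L2_01 = {f. f \<in> borel_measurable (lebesgue_on {0..1}) \<and>
               integrable (lebesgue_on {0..1}) (\<lambda>x. (cmod (f x))^2)}"

definition V_op :: "(real \<Rightarrow> real) \<Rightarrow> (real \<Rightarrow> complex) \<Rightarrow> real \<Rightarrow> complex" where
  "V_op \<phi> f x = (LINT t:{0..\<phi> x}|lebesgue. f t)"

definition V_shift :: "(real \<Rightarrow> real) \<Rightarrow> complex \<Rightarrow> (real \<Rightarrow> complex) \<Rightarrow> real \<Rightarrow> complex" where
  "V_shift \<phi> \<mu> f = (\<lambda>x. V_op \<phi> f x - \<mu> * f x)"

text \<open>Equality in L2[0,1] means equality almost everywhere on [0,1].\<close>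
definition ae_zero :: "(real \<Rightarrow> complex) \<Rightarrow> bool" where
  "ae_zero f \<longleftrightarrow> (AE x in lebesgue_on {0..1}. f x = 0)"

definition eigenvalue :: "(real \<Rightarrow> real) \<Rightarrow> complex \<Rightarrow> bool" where
  "eigenvalue \<phi> \<mu> \<longleftrightarrow> (\<exists>f\<in>L2_01. \<not> ae_zero f \<and> ae_zero (V_shift \<phi> \<mu> f))"

definition gen_eigenspace :: "(real \<Rightarrow> real) \<Rightarrow> complex \<Rightarrow> (real \<Rightarrow> complex) set" where
  "gen_eigenspace \<phi> \<mu> = {f \<in> L2_01. \<exists>k. ae_zero ((V_shift \<phi> \<mu> ^^ k) f)}"

definition indep_L2 :: "(real \<Rightarrow> complex) set \<Rightarrow> bool" where
  "indep_L2 F \<longleftrightarrow> (\<forall>c. ae_zero (\<lambda>x. \<Sum>f\<in>F. c f * f x) \<longrightarrow> (\<forall>f\<in>F. c f = 0))"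

definition alg_mult :: "(real \<Rightarrow> real) \<Rightarrow> complex \<Rightarrow> enat" where
  "alg_mult \<phi> \<mu> = Sup {enat (card F) | F. finite F \<and> F \<subseteq> gen_eigenspace \<phi> \<mu> \<and> indep_L2 F}"

definition enumerates_eigs :: "(real \<Rightarrow> real) \<Rightarrow> enat \<Rightarrow> (nat \<Rightarrow> complex) \<Rightarrow> bool" where
  "enumerates_eigs \<phi> \<omega> lam \<longleftrightarrow>
     (\<forall>n. enat n < \<omega> \<longrightarrow> lam n \<noteq> 0 \<and> eigenvalue \<phi> (lam n)) \<and>
     (\<forall>\<mu>. \<mu> \<noteq> 0 \<and> eigenvalue \<phi> \<mu> \<longrightarrow>
        alg_mult \<phi> \<mu> = (let S = {n. enat n < \<omega> \<and> lam n = \<mu>} in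
                          if finite S then enat (card S) else \<infinity>))"

end

(*
  V f = <f, 1> 1 - W f, where W f(x) is the integral of f over [phi x, 1]. Since phi x >= x, W is a
  quasinilpotent Volterra operator, so V is a rank one perturbation of a quasinilpotent one. Put
  e_z = (1 + z W)^(-1) 1 and D(z) = 1 - z <e_z, 1>; then (1 - z V) e_z = D(z) 1. Hence mu /= 0 is an
  eigenvalue iff D(1/mu) = 0, its geometric multiplicity is one, and, differentiating the identity in
  z, the Taylor coefficients of e_z at 1/mu form a basis of the generalized eigenspace of length the
  order of the zero of D. Here D(z) = sum_n (-z)^n a_n, where a_n is the volume of the chains with
  phi x_i < x_(i+1). Because phi x > x in the interior, D grows more slowly than exp(delta |z|) for
  every delta > 0. Dividing D by the Blaschke product of its zeros in |z| < R and applying the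
  Schwarz lemma to the logarithm of the quotient bounds the number of zeros by o(R) and shows that
  the sum of 1/z_n over |z_n| < R tends to -D'(0) = a_1 = 1 (Lindeloef). The number of zeros is
  finite iff D is a polynomial iff long chains do not exist.
*)
theory Submission
  imports Defs "HOL-Complex_Analysis.Complex_Analysis"
begin

section \<open>Zeros of entire functions of minimal exponential type\<close>

text \<open>The counting bound gives (3) but not convergence of the sum of |lambda_n|, so (2) cannot
  be read off from an absolutely convergent trace formula; the discs |z| < R prescribe the order of
  summation. Ordinary exponential type would not suffice either: a factor exp(a z) has no zeros and
  yet changes D'(0). This is why every delta > 0 is wanted. The obstacle to such growth is that phi
  may touch the diagonal at 0 and at 1. Near these points only an exponential bound is used, but on
  intervals whose length is at choice; on the compact rest phi gains a fixed amount per step, so a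
  number of steps independent of z suffices, each costing a factor linear in |z|. The same principle
  yields the hard direction of (1): a zero-free entire function of minimal type is constant, so
  finitely many zeros make D a polynomial. The coefficients of D are volumes up to sign, so it
  remains to decide when chains of a given length fill a positive volume.\<close>

text \<open>\<open>q\<close> is the mirror image of \<open>g c\<close> in the line
  \<open>Re u = A\<close>, so \<open>(u - g c) / (q - u)\<close> maps the half-plane
  \<open>Re u < A\<close> into the unit disc and \<open>g c\<close> to 0. The Schwarz lemma then
  bounds the derivative.\<close>

lemma deriv_le_of_Re_less:
  fixes g :: "complex \<Rightarrow> complex"
  assumes g: "g holomorphic_on ball c R" and R: "R > 0"
    and less: "\<And>w. w \<in> ball c R \<Longrightarrow> Re (g w) < A"
  shows "cmod (deriv g c) \<le> 2 * (A - Re (g c)) / R"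
proof -
  define q where "q = 2 * of_real A - cnj (g c)"
  have ball: "c + of_real R * w \<in> ball c R" if "cmod w < 1" for w
    using that R by (simp add: dist_norm norm_mult)
  have c: "c \<in> ball c R" using R by simp
  have closer: "cmod (u - g c) < cmod (q - u)" if "Re u < A" for u
  proof -
    have "0 < (A - Re u) * (A - Re (g c))" using that less[OF c] by simp
    then have "(cmod (u - g c))\<^sup>2 < (cmod (q - u))\<^sup>2"
      unfolding cmod_power2 q_def by (simp add: power2_eq_square algebra_simps)
    then show ?thesis using power2_less_imp_less norm_ge_zero by blast
  qed
  define h where "h = (\<lambda>w. (g (c + of_real R * w) - g c) / (q - g (c + of_real R * w)))"
  have qne: "q - g (c + of_real R * w) \<noteq> 0" if "cmod w < 1" for w
    using closer[OF less[OF ball[OF that]]] by (metis norm_zero norm_not_less_zero)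
  have gc: "(\<lambda>w. g (c + of_real R * w)) holomorphic_on ball 0 1"
    by (rule holomorphic_on_compose_gen[of "\<lambda>w. c + of_real R * w" "ball 0 1" g "ball c R", unfolded o_def])
      (use g ball in \<open>auto intro!: holomorphic_intros\<close>)
  have "norm (deriv h 0) \<le> 1"
  proof (rule Schwarz_Lemma(2)[where \<xi> = 0])
    show "h holomorphic_on ball 0 1"
      unfolding h_def using qne by (auto intro!: holomorphic_intros gc)
    show "h 0 = 0" by (simp add: h_def)
    show "norm (h z) < 1" if "norm z < 1" for z
      using closer[OF less[OF ball[OF that]]] qne[OF that]
      by (simp add: h_def norm_divide divide_less_eq)
  qed simp
  moreover have "deriv h 0 = of_real R * deriv g c / (q - g c)"
  proof (rule DERIV_imp_deriv)
    have dg: "(g has_field_derivative deriv g c) (at (c + of_real R * 0))"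
      using holomorphic_derivI[OF g open_ball c] by simp
    have dgc: "((\<lambda>w. g (c + of_real R * w)) has_field_derivative (deriv g c * of_real R)) (at 0)"
      by (rule DERIV_chain2[where f = g and g = "\<lambda>w. c + of_real R * w", OF dg]) (auto intro!: derivative_eq_intros)
    have "q - g c \<noteq> 0" using qne[of 0] by simp
    then show "(h has_field_derivative of_real R * deriv g c / (q - g c)) (at 0)"
      unfolding h_def by (auto intro!: derivative_eq_intros dgc simp: divide_simps)
  qed
  moreover have "q - g c = of_real (2 * (A - Re (g c)))"
    by (simp add: q_def complex_eq_iff)
  ultimately have "R * cmod (deriv g c) / \<bar>2 * (A - Re (g c))\<bar> \<le> 1"
    using R by (simp only: norm_divide norm_mult norm_of_real abs_of_pos)
  then show ?thesis using R less[OF c] by (simp add: field_simps)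
qed

text \<open>A zero-free function on a disc has a holomorphic logarithm, whose real part is the
  logarithm of the modulus. The previous bound wants a strict inequality, so it is applied to every
  \<open>A' > A\<close>.\<close>

lemma logderiv_le:
  fixes G :: "complex \<Rightarrow> complex"
  assumes G: "G holomorphic_on ball c R" and R: "R > 0"
    and nz: "\<And>w. w \<in> ball c R \<Longrightarrow> G w \<noteq> 0"
    and le: "\<And>w. w \<in> ball c R \<Longrightarrow> cmod (G w) \<le> exp A"
  shows "cmod (deriv G c / G c) \<le> 2 * (A - ln (cmod (G c))) / R"
proof -
  have "simply_connected (ball c R)" by (simp add: convex_imp_simply_connected)
  then obtain g where g: "g holomorphic_on ball c R" and Gg: "\<And>z. z \<in> ball c R \<Longrightarrow> G z = exp (g z)"
    using G nz simply_connected_eq_holomorphic_log[of "ball c R"] by auto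
  have c: "c \<in> ball c R" using R by simp
  have Re: "Re (g w) \<le> A" if "w \<in> ball c R" for w
    using le[OF that] by (simp add: Gg[OF that])
  have ln: "ln (cmod (G c)) = Re (g c)" by (simp add: Gg[OF c])
  have "(G has_field_derivative exp (g c) * deriv g c) (at c)"
  proof (rule has_field_derivative_transform_within_open[OF _ open_ball c])
    show "((\<lambda>z. exp (g z)) has_field_derivative exp (g c) * deriv g c) (at c)"
      by (auto intro!: derivative_eq_intros holomorphic_derivI[OF g open_ball c])
  qed (simp add: Gg)
  then have eq: "deriv G c / G c = deriv g c"
    by (simp add: DERIV_imp_deriv Gg[OF c])
  have "cmod (deriv g c) \<le> 2 * (A' - Re (g c)) / R" if "A' > A" for A'
    by (rule deriv_le_of_Re_less[OF g R]) (use Re that in force)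
  then have "cmod (deriv g c) * R / 2 + Re (g c) \<le> A'" if "A' > A" for A'
    using that R by (fastforce simp: field_simps)
  then have "cmod (deriv g c) * R / 2 + Re (g c) \<le> A"
    by (rule dense_ge)
  then show ?thesis unfolding eq ln using R by (simp add: field_simps)
qed

section \<open>Orders of zeros and division by finitely many zeros\<close>

text \<open>The cofactor is entire, not merely holomorphic near \<open>a\<close>, so that zeros can
  be divided out one after another. Order 0 means \<open>f a \<noteq> 0\<close>.\<close>

definition has_zero_order :: "(complex \<Rightarrow> complex) \<Rightarrow> complex \<Rightarrow> nat \<Rightarrow> bool" where
  "has_zero_order f a m \<longleftrightarrow>
     (\<exists>q. q holomorphic_on UNIV \<and> q a \<noteq> 0 \<and> (\<forall>w. f w = (w - a) ^ m * q w))"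

text \<open>The Taylor series of an entire function converges everywhere; after its first
  \<open>m\<close> terms, which vanish, are dropped, the shifted series is an entire
  cofactor.\<close>

lemma has_zero_order_deriv:
  assumes f: "f holomorphic_on UNIV"
    and zero: "\<And>j. j < m \<Longrightarrow> (deriv ^^ j) f a = 0" and nz: "(deriv ^^ m) f a \<noteq> 0"
  shows "has_zero_order f a m"
proof -
  define d where "d j = (deriv ^^ j) f a / fact j" for j
  have sums: "(\<lambda>j. d j * (w - a) ^ j) sums f w" for w
  proof -
    have "f holomorphic_on ball a (dist a w + 1)" using f holomorphic_on_subset by blast
    then show ?thesis unfolding d_def by (rule holomorphic_power_series) simp
  qed
  define q where "q w = (if w = a then d m else f w / (w - a) ^ m)" for w
  have qs: "(\<lambda>j. d (j + m) * (w - a) ^ j) sums q w" for w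
  proof (cases "w = a")
    case True
    then show ?thesis using powser_sums_zero[of "\<lambda>j. d (j + m)"] by (simp add: q_def)
  next
    case False
    have "(\<lambda>j. d (j + m) * (w - a) ^ (j + m)) sums (f w - (\<Sum>j<m. d j * (w - a) ^ j))"
      using sums_split_initial_segment[OF sums] .
    moreover have "(\<Sum>j<m. d j * (w - a) ^ j) = 0"
      by (rule sum.neutral) (auto simp: d_def zero)
    ultimately have "(\<lambda>j. d (j + m) * (w - a) ^ (j + m) / (w - a) ^ m) sums (f w / (w - a) ^ m)"
      by (intro sums_divide) simp
    then show ?thesis using False by (simp add: q_def power_add)
  qed
  have "q holomorphic_on UNIV"
  proof -
    have "q holomorphic_on ball a (dist a w + 1)" for w
      by (rule power_series_holomorphic[of _ _ "\<lambda>j. d (j + m)"]) (rule qs)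
    then have "q field_differentiable (at w)" for w
      using holomorphic_on_imp_differentiable_at[OF _ open_ball] by (metis mem_ball less_add_one)
    then show ?thesis by (simp add: holomorphic_on_def)
  qed
  moreover have "f w = (w - a) ^ m * q w" for w
  proof (cases "w = a")
    case True
    show ?thesis
    proof (cases "m = 0")
      case False
      then have "f a = 0" using zero[of 0] by simp
      then show ?thesis using True False by simp
    qed (use True in \<open>simp add: q_def d_def\<close>)
  qed (simp add: q_def)
  moreover have "q a \<noteq> 0" using nz by (simp add: q_def d_def)
  ultimately show ?thesis unfolding has_zero_order_def by blast
qed

lemma has_zero_order_exists:
  assumes f: "f holomorphic_on UNIV" and nz: "f b \<noteq> 0"
  obtains m where "has_zero_order f a m" "(deriv ^^ m) f a \<noteq> 0" "\<And>j. j < m \<Longrightarrow> (deriv ^^ j) f a = 0"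
proof -
  define m where "m = (LEAST j. (deriv ^^ j) f a \<noteq> 0)"
  have ex: "\<exists>j. (deriv ^^ j) f a \<noteq> 0"
    using holomorphic_fun_eq_0_on_connected[OF f open_UNIV connected_UNIV, of a b] nz by auto
  have m: "(deriv ^^ m) f a \<noteq> 0" unfolding m_def using LeastI_ex[OF ex] .
  have less: "(deriv ^^ j) f a = 0" if "j < m" for j
    using not_less_Least[of j] that unfolding m_def by blast
  show ?thesis using that has_zero_order_deriv[OF f less m] m less by blast
qed

text \<open>The common power cancels only off \<open>b\<close>. The surplus factor
  \<open>(w - b) ^ (k - m)\<close> is left there, and continuity carries its zero over to
  \<open>h b\<close>.\<close>

lemma power_factor_unique_aux:
  fixes h q :: "complex \<Rightarrow> complex"
  assumes "\<And>w. (w - b) ^ m * h w = (w - b) ^ k * q w" "h holomorphic_on UNIV" "q holomorphic_on UNIV"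
    and "m < k"
  shows "h b = 0"
proof -
  have eq: "h w = (w - b) ^ (k - m) * q w" if "w \<noteq> b" for w
  proof -
    have "(w - b) ^ k = (w - b) ^ m * (w - b) ^ (k - m)"
      using \<open>m < k\<close> by (simp flip: power_add)
    then show ?thesis using assms(1)[of w] that by simp
  qed
  have "isCont h b" "isCont q b"
    using assms(2,3) holomorphic_on_imp_continuous_on continuous_on_eq_continuous_at open_UNIV by blast+
  then have "(h \<longlongrightarrow> h b) (at b)" "(q \<longlongrightarrow> q b) (at b)"
    by (simp_all add: isCont_def)
  moreover have "((\<lambda>w. (w - b) ^ (k - m) * q w) \<longlongrightarrow> (b - b) ^ (k - m) * q b) (at b)"
    by (intro tendsto_intros \<open>(q \<longlongrightarrow> q b) (at b)\<close>)
  moreover have "((\<lambda>w. (w - b) ^ (k - m) * q w) \<longlongrightarrow> h b) (at b)"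
  proof (rule Lim_transform_eventually[OF \<open>(h \<longlongrightarrow> h b) (at b)\<close>])
    show "\<forall>\<^sub>F w in at b. h w = (w - b) ^ (k - m) * q w"
      using eq by (auto simp: eventually_at intro: exI[of _ 1])
  qed
  ultimately have "h b = (b - b) ^ (k - m) * q b"
    using tendsto_unique[OF trivial_limit_at] by blast
  then show ?thesis using \<open>m < k\<close> by simp
qed

lemma power_factor_unique:
  fixes h q :: "complex \<Rightarrow> complex"
  assumes "\<And>w. (w - b) ^ m * h w = (w - b) ^ k * q w" "h holomorphic_on UNIV" "q holomorphic_on UNIV"
    and "h b \<noteq> 0" "q b \<noteq> 0"
  shows "m = k"
  using power_factor_unique_aux[OF assms(1-3)] power_factor_unique_aux[OF assms(1)[symmetric] assms(3,2)]
    assms(4,5) by (meson linorder_neqE_nat)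

lemma factor_finite_zeros:
  assumes f: "f holomorphic_on UNIV" and nz: "f c \<noteq> 0" and Z: "finite Z"
    and ord: "\<And>a. a \<in> Z \<Longrightarrow> has_zero_order f a (m a)"
  obtains Q where "Q holomorphic_on UNIV" "\<And>a. a \<in> Z \<Longrightarrow> Q a \<noteq> 0"
    "\<And>w. f w = (\<Prod>a\<in>Z. (w - a) ^ m a) * Q w"
proof -
  have "\<exists>Q. Q holomorphic_on UNIV \<and> (\<forall>a\<in>Z. Q a \<noteq> 0) \<and> (\<forall>w. f w = (\<Prod>a\<in>Z. (w - a) ^ m a) * Q w)"
    using Z ord
  proof (induction Z)
    case empty
    then show ?case using f by auto
  next
    case (insert b Z)
    then obtain Q where Q: "Q holomorphic_on UNIV" "\<And>a. a \<in> Z \<Longrightarrow> Q a \<noteq> 0"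
      and fQ: "\<And>w. f w = (\<Prod>a\<in>Z. (w - a) ^ m a) * Q w" by auto
    obtain h where h: "h holomorphic_on UNIV" "h b \<noteq> 0" and fh: "\<And>w. f w = (w - b) ^ m b * h w"
      using insert.prems[of b] unfolding has_zero_order_def by auto
    have "Q c \<noteq> 0" using fQ[of c] nz by auto
    then obtain k where "has_zero_order Q b k" using has_zero_order_exists[OF Q(1)] by metis
    then obtain q where q: "q holomorphic_on UNIV" "q b \<noteq> 0" and Qq: "\<And>w. Q w = (w - b) ^ k * q w"
      unfolding has_zero_order_def by blast
    \<comment> \<open>The product over \<open>Z\<close> does not vanish at \<open>b\<close>, because
      \<open>b \<notin> Z\<close>, so \<open>f\<close> and the current cofactor \<open>Q\<close>
      have the same order at \<open>b\<close>.\<close>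
    have "m b = k"
    proof (rule power_factor_unique[where q = "\<lambda>w. (\<Prod>a\<in>Z. (w - a) ^ m a) * q w", OF _ h(1)])
      show "(w - b) ^ m b * h w = (w - b) ^ k * ((\<Prod>a\<in>Z. (w - a) ^ m a) * q w)" for w
        using fh[of w] fQ[of w] Qq[of w] by (simp add: mult.left_commute)
      show "(\<Prod>a\<in>Z. (b - a) ^ m a) * q b \<noteq> 0" using q(2) insert.hyps by auto
    qed (auto intro!: holomorphic_intros q h)
    have "f w = (\<Prod>a\<in>insert b Z. (w - a) ^ m a) * q w" for w
      using fQ[of w] Qq[of w] insert.hyps \<open>m b = k\<close> by simp
    moreover have "q a \<noteq> 0" if "a \<in> insert b Z" for a
      using that q(2) Q(2)[of a] Qq[of a] by auto
    ultimately show ?case using q(1) by blast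
  qed
  then show ?thesis using that by blast
qed

section \<open>Counting zeros and summing their reciprocals\<close>

text \<open>\<open>z\<close> lists the zeros with multiplicity, each fibre having as many indices as
  the order of its zero. An empty fibre over a zero would mean order 0, so no zero is left
  out.\<close>

locale minimal_type =
  fixes f :: "complex \<Rightarrow> complex" and I :: "nat set" and z :: "nat \<Rightarrow> complex"
  assumes holo: "f holomorphic_on UNIV" and f_0: "f 0 = 1"
    and growth: "\<And>\<delta>. \<delta> > 0 \<Longrightarrow> \<exists>C. \<forall>w. cmod (f w) \<le> exp (\<delta> * cmod w + C)"
    and zero: "\<And>n. n \<in> I \<Longrightarrow> f (z n) = 0"
    and finite_fibre: "\<And>a. f a = 0 \<Longrightarrow> finite {n\<in>I. z n = a}"
    and order: "\<And>a. f a = 0 \<Longrightarrow> has_zero_order f a (card {n\<in>I. z n = a})"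
begin

lemma zero_nonzero: "n \<in> I \<Longrightarrow> z n \<noteq> 0"
  using zero f_0 by force

lemma zero_in_range:
  assumes "f w = 0"
  shows "w \<in> z ` I"
proof (rule ccontr)
  assume "w \<notin> z ` I"
  then have "{n\<in>I. z n = w} = {}" by auto
  then have "card {n\<in>I. z n = w} = 0" by (simp only: card.empty)
  then have "has_zero_order f w 0" using order[OF assms] by (simp only:)
  then show False using assms unfolding has_zero_order_def by auto
qed

lemma finite_zeros: "finite {w \<in> cball 0 R. f w = 0}" if "n \<in> I" for n R
proof (rule holomorphic_compact_finite_zeros[OF holo])
  show "\<not> f constant_on UNIV"
    using zero[OF that] f_0 unfolding constant_on_def by (metis UNIV_I zero_neq_one)
qed auto

lemma finite_indices: "finite {n\<in>I. cmod (z n) \<le> R}"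
proof (cases "I = {}")
  case False
  then obtain n0 where "n0 \<in> I" by blast
  have "{n\<in>I. cmod (z n) \<le> R} \<subseteq> (\<Union>a\<in>{w \<in> cball 0 R. f w = 0}. {n\<in>I. z n = a})"
    using zero by auto
  then show ?thesis
    by (rule finite_subset) (use finite_zeros[OF \<open>n0 \<in> I\<close>] finite_fibre in auto)
qed simp

lemma finite_indices_less: "finite {n\<in>I. cmod (z n) < R}"
  by (rule finite_subset[OF _ finite_indices[of R]]) auto

lemma factor:
  assumes J: "finite J" "J \<subseteq> I" and fibre: "\<And>m n. m \<in> I \<Longrightarrow> n \<in> J \<Longrightarrow> z m = z n \<Longrightarrow> m \<in> J"
  obtains Q where "Q holomorphic_on UNIV" "\<And>w. f w = (\<Prod>n\<in>J. (w - z n)) * Q w"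
    "\<And>w. Q w = 0 \<Longrightarrow> f w = 0 \<and> w \<notin> z ` J"
proof -
  have fib: "{n\<in>I. z n = a} = {n\<in>J. z n = a}" if "a \<in> z ` J" for a
    using that J fibre by auto
  have "has_zero_order f a (card {n\<in>J. z n = a})" if "a \<in> z ` J" for a
    using order[of a] zero that J fib[OF that] by auto
  then obtain Q where Q: "Q holomorphic_on UNIV" "\<And>a. a \<in> z ` J \<Longrightarrow> Q a \<noteq> 0"
    and fQ: "\<And>w. f w = (\<Prod>a\<in>z ` J. (w - a) ^ card {n\<in>J. z n = a}) * Q w"
    using factor_finite_zeros[of f 0 "z ` J" "\<lambda>a. card {n\<in>J. z n = a}"] holo f_0 J(1) by auto
  have "(\<Prod>a\<in>z ` J. (w - a) ^ card {n\<in>J. z n = a}) = (\<Prod>n\<in>J. (w - z n))" for w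
  proof -
    have "(\<Prod>n\<in>J. (w - z n)) = (\<Prod>a\<in>z ` J. \<Prod>n\<in>{n\<in>J. z n = a}. (w - z n))"
      using J(1) by (rule prod.image_gen)
    also have "\<dots> = (\<Prod>a\<in>z ` J. (w - a) ^ card {n\<in>J. z n = a})"
      by (intro prod.cong refl) simp
    finally show ?thesis ..
  qed
  then show ?thesis using that[of Q] Q fQ by auto
qed

text \<open>Multiplying the cofactor of the zeros in the disc by the denominators of the Blaschke factors
  does not change \<open>\<bar>f\<bar>\<close> on the circle.\<close>

lemma blaschke:
  assumes R: "R > 0" and le: "\<And>w. cmod w = R \<Longrightarrow> cmod (f w) \<le> exp A"
  defines "J \<equiv> {n\<in>I. cmod (z n) < R}"
  obtains G where "G holomorphic_on UNIV" "\<And>w. w \<in> ball 0 R \<Longrightarrow> G w \<noteq> 0"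
    "\<And>w. w \<in> ball 0 R \<Longrightarrow> cmod (G w) \<le> exp A"
    "\<And>w. f w * (\<Prod>n\<in>J. (of_real (R\<^sup>2) - cnj (z n) * w) / of_real R) = G w * (\<Prod>n\<in>J. (w - z n))"
proof -
  have J: "finite J" unfolding J_def by (rule finite_indices_less)
  obtain Q where Q: "Q holomorphic_on UNIV" and fQ: "\<And>w. f w = (\<Prod>n\<in>J. (w - z n)) * Q w"
    and Q0: "\<And>w. Q w = 0 \<Longrightarrow> f w = 0 \<and> w \<notin> z ` J"
    using factor[OF J] unfolding J_def by auto
  define B where "B w = (\<Prod>n\<in>J. (of_real (R\<^sup>2) - cnj (z n) * w) / of_real R)" for w
  define G where "G w = Q w * B w" for w
  have B: "B holomorphic_on UNIV" unfolding B_def using R by (auto intro!: holomorphic_intros)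
  have B0: "B w \<noteq> 0" if "w \<in> ball 0 R" for w
  proof -
    have "(of_real (R\<^sup>2) - cnj (z n) * w) / of_real R \<noteq> 0" if "n \<in> J" for n
    proof
      assume "(of_real (R\<^sup>2) - cnj (z n) * w) / of_real R = 0"
      then have "cnj (z n) * w = of_real (R\<^sup>2)" using R by (simp del: of_real_power)
      then have "cmod (z n) * cmod w = R\<^sup>2"
        by (metis complex_mod_cnj norm_mult norm_of_real abs_of_nonneg zero_le_power2)
      moreover have "cmod (z n) * cmod w < R * R"
        using that \<open>w \<in> ball 0 R\<close> R by (intro mult_strict_mono') (auto simp: J_def)
      ultimately show False by (simp add: power2_eq_square)
    qed
    then show ?thesis unfolding B_def prod_zero_iff[OF J] by blast
  qed
  \<comment> \<open>Zeros on the circle itself stay in \<open>Q\<close>, so this holds on the open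
    disc only.\<close>
  have Q1: "Q w \<noteq> 0" if "w \<in> ball 0 R" for w
  proof
    assume "Q w = 0"
    then have "f w = 0" "w \<notin> z ` J" using Q0 by auto
    then show False using zero_in_range[of w] that unfolding J_def by auto
  qed
  have G: "G holomorphic_on UNIV" unfolding G_def using Q B by (intro holomorphic_intros)
  have sphere: "cmod (G w) \<le> exp A" if w: "cmod w = R" for w
  proof -
    have "cmod ((of_real (R\<^sup>2) - cnj (z n) * w) / of_real R) = cmod (w - z n)" for n
    proof -
      have "of_real (R\<^sup>2) - cnj (z n) * w = w * cnj (w - z n)"
        using w by (simp add: algebra_simps complex_norm_square[symmetric])
      then show ?thesis using w R by (simp add: norm_divide norm_mult del: complex_cnj_diff)
    qed
    then have "cmod (B w) = cmod (\<Prod>n\<in>J. (w - z n))"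
      unfolding B_def by (simp flip: prod_norm)
    then have "cmod (G w) = cmod (f w)" unfolding G_def fQ by (simp add: norm_mult)
    then show ?thesis using le[OF w] by simp
  qed
  have "cmod (G w) \<le> exp A" if "w \<in> ball 0 R" for w
  proof (rule maximum_modulus_frontier[of G "cball 0 R"])
    show "G holomorphic_on interior (cball 0 R)" using G holomorphic_on_subset by blast
    show "continuous_on (closure (cball 0 R)) G"
      using G holomorphic_on_imp_continuous_on holomorphic_on_subset by blast
  qed (use that R sphere in \<open>auto simp: frontier_cball\<close>)
  moreover have "f w * B w = G w * (\<Prod>n\<in>J. (w - z n))" for w
    unfolding G_def fQ[of w] by simp
  ultimately show ?thesis using that[of G] G Q1 B0 unfolding B_def G_def by auto
qed

text \<open>Both parts come from the identity \<open>f * B = G * P\<close> at 0: its value gives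
  Jensen's inequality, its logarithmic derivative the sum of reciprocals. There each zero adds an
  error \<open>cnj (z n) / R\<^sup>2\<close> of modulus at most \<open>1 / R\<close>, whence the
  term \<open>card J\<close>.\<close>

lemma jensen:
  assumes R: "R > 0" and le: "\<And>w. cmod w = R \<Longrightarrow> cmod (f w) \<le> exp A"
  defines "J \<equiv> {n\<in>I. cmod (z n) < R}"
  shows "(\<Prod>n\<in>J. R / cmod (z n)) \<le> exp A" 
    and "cmod ((\<Sum>n\<in>J. 1 / z n) + deriv f 0) \<le> (real (card J) + 2 * A) / R"
proof -
  have J: "finite J" unfolding J_def by (rule finite_indices_less)
  have z0: "z n \<noteq> 0" if "n \<in> J" for n using zero_nonzero that unfolding J_def by auto
  obtain G where G: "G holomorphic_on UNIV" "\<And>w. w \<in> ball 0 R \<Longrightarrow> G w \<noteq> 0"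
    "\<And>w. w \<in> ball 0 R \<Longrightarrow> cmod (G w) \<le> exp A"
    and fG: "\<And>w. f w * (\<Prod>n\<in>J. (of_real (R\<^sup>2) - cnj (z n) * w) / of_real R) = G w * (\<Prod>n\<in>J. (w - z n))"
    by (rule blaschke[OF R le, folded J_def]) blast+
  have "(\<Prod>n\<in>J. of_real R) = G 0 * (\<Prod>n\<in>J. - z n)"
    using fG[of 0] f_0 R by (simp add: power2_eq_square)
  then have "cmod (\<Prod>n\<in>J. of_real R) = cmod (G 0) * cmod (\<Prod>n\<in>J. - z n)"
    by (simp only: norm_mult)
  then have "(\<Prod>n\<in>J. R) = cmod (G 0) * (\<Prod>n\<in>J. cmod (z n))"
    using R by (simp only: prod_norm[symmetric] norm_of_real norm_minus_cancel abs_of_pos)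
  moreover have "(\<Prod>n\<in>J. cmod (z n)) \<noteq> 0" using J z0 by (simp add: prod_zero_iff)
  ultimately have "cmod (G 0) = (\<Prod>n\<in>J. R / cmod (z n))"
    by (simp add: prod_dividef)
  then show prod_le: "(\<Prod>n\<in>J. R / cmod (z n)) \<le> exp A" using G(3)[of 0] R by simp
  have "cmod (G 0) \<ge> 1"
    unfolding \<open>cmod (G 0) = _\<close>
    by (rule prod_ge_1) (use z0 R in \<open>auto simp: J_def field_simps\<close>)
  then have ln: "ln (cmod (G 0)) \<ge> 0" by simp
  have "cmod (deriv G 0 / G 0) \<le> 2 * (A - ln (cmod (G 0))) / R"
    by (rule logderiv_le) (use G R holomorphic_on_subset in auto)
  also have "\<dots> \<le> 2 * A / R" using ln R by (simp add: divide_right_mono)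
  finally have dG: "cmod (deriv G 0 / G 0) \<le> 2 * A / R" .
  define P where "P w = (\<Prod>n\<in>J. (w - z n))" for w
  define B where "B w = (\<Prod>n\<in>J. (of_real (R\<^sup>2) - cnj (z n) * w) / of_real R)" for w
  have P0: "P 0 \<noteq> 0" unfolding P_def using z0 J by auto
  have B0: "B 0 \<noteq> 0" unfolding B_def using R J by auto
  have dP: "(P has_field_derivative P 0 * (\<Sum>n\<in>J. 1 / (0 - z n))) (at 0)"
    unfolding P_def
    by (rule has_field_derivative_prod'[where f' = "\<lambda>_. 1"]) (use z0 in \<open>auto intro!: derivative_eq_intros\<close>)
  have dB: "(B has_field_derivative B 0 * (\<Sum>n\<in>J. - cnj (z n) / of_real (R\<^sup>2))) (at 0)"
  proof -
    have "(B has_field_derivative B 0 *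
        (\<Sum>n\<in>J. (- cnj (z n) / of_real R) / ((of_real (R\<^sup>2) - cnj (z n) * 0) / of_real R))) (at 0)"
      unfolding B_def
      by (rule has_field_derivative_prod') (use R in \<open>auto intro!: derivative_eq_intros\<close>)
    then show ?thesis using R by simp
  qed
  have df: "(f has_field_derivative deriv f 0) (at 0)" and dG0: "(G has_field_derivative deriv G 0) (at 0)"
    using holomorphic_derivI[OF _ open_UNIV UNIV_I] holo G(1) by auto
  have "((\<lambda>w. f w * B w) has_field_derivative
        deriv f 0 * B 0 + B 0 * (\<Sum>n\<in>J. - cnj (z n) / of_real (R\<^sup>2)) * f 0) (at 0)"
      "((\<lambda>w. G w * P w) has_field_derivative
        deriv G 0 * P 0 + P 0 * (\<Sum>n\<in>J. 1 / (0 - z n)) * G 0) (at 0)"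
    using DERIV_mult[OF df dB] DERIV_mult[OF dG0 dP] by blast+
  moreover have eq: "(\<lambda>w. f w * B w) = (\<lambda>w. G w * P w)" using fG by (auto simp: B_def P_def)
  ultimately have "deriv f 0 * B 0 + B 0 * (\<Sum>n\<in>J. - cnj (z n) / of_real (R\<^sup>2))
      = deriv G 0 * P 0 + P 0 * (\<Sum>n\<in>J. 1 / (0 - z n)) * G 0"
    using DERIV_unique unfolding eq by (fastforce simp: f_0)
  moreover have B0G: "B 0 = G 0 * P 0" using fun_cong[OF eq, of 0] f_0 by simp
  ultimately have "deriv f 0 * (G 0 * P 0) + (G 0 * P 0) * (\<Sum>n\<in>J. - cnj (z n) / of_real (R\<^sup>2))
      = (deriv G 0 / G 0) * (G 0 * P 0) + (\<Sum>n\<in>J. 1 / (0 - z n)) * (G 0 * P 0)"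
    using G(2)[of 0] R by (simp add: field_simps)
  then have "(deriv f 0 + (\<Sum>n\<in>J. - cnj (z n) / of_real (R\<^sup>2))) * (G 0 * P 0)
      = (deriv G 0 / G 0 + (\<Sum>n\<in>J. 1 / (0 - z n))) * (G 0 * P 0)"
    by (simp add: algebra_simps)
  then have "deriv f 0 + (\<Sum>n\<in>J. - cnj (z n) / of_real (R\<^sup>2)) = deriv G 0 / G 0 + (\<Sum>n\<in>J. 1 / (0 - z n))"
    using B0 B0G by (metis mult_cancel_right)
  then have "(\<Sum>n\<in>J. 1 / z n) + deriv f 0 = deriv G 0 / G 0 + (\<Sum>n\<in>J. cnj (z n) / of_real (R\<^sup>2))"
    by (simp add: sum_negf algebra_simps)
  moreover have "cmod (\<Sum>n\<in>J. cnj (z n) / of_real (R\<^sup>2)) \<le> card J * (1 / R)"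
  proof (rule sum_norm_bound)
    show "cmod (cnj (z n) / of_real (R\<^sup>2)) \<le> 1 / R" if "n \<in> J" for n
    proof -
      have "cmod (cnj (z n) / of_real (R\<^sup>2)) = cmod (z n) / R\<^sup>2"
        by (simp add: norm_divide norm_power)
      also have "\<dots> \<le> R / R\<^sup>2" using that by (intro divide_right_mono) (auto simp: J_def)
      finally show ?thesis using R by (simp add: power2_eq_square)
    qed
  qed
  ultimately show "cmod ((\<Sum>n\<in>J. 1 / z n) + deriv f 0) \<le> (real (card J) + 2 * A) / R"
    using dG norm_triangle_ineq[of "deriv G 0 / G 0" "\<Sum>n\<in>J. cnj (z n) / of_real (R\<^sup>2)"]
    by (simp add: add_divide_distrib)
qed

text \<open>On the circle enlarged by the factor \<open>exp 1\<close>, every zero to be counted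
  contributes at least \<open>exp 1\<close> to Jensen's product and every other zero at least
  1.\<close>

lemma count_le:
  assumes R: "R > 0" and le: "\<And>w. cmod w \<le> exp 1 * R \<Longrightarrow> cmod (f w) \<le> exp A"
  shows "real (card {n\<in>I. cmod (z n) \<le> R}) \<le> A"
proof -
  define J where "J = {n\<in>I. cmod (z n) < exp 1 * R}"
  have J: "finite J" unfolding J_def by (rule finite_indices_less)
  have e: "R < exp 1 * R" using R by simp
  have sub: "{n\<in>I. cmod (z n) \<le> R} \<subseteq> J" unfolding J_def using e by auto
  have "exp (card {n\<in>I. cmod (z n) \<le> R}) = (\<Prod>n\<in>{n\<in>I. cmod (z n) \<le> R}. exp 1 :: real)"
    by (simp add: exp_of_nat_mult[symmetric])
  also have "\<dots> \<le> (\<Prod>n\<in>{n\<in>I. cmod (z n) \<le> R}. exp 1 * R / cmod (z n))"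
    by (rule prod_mono) (use zero_nonzero in \<open>auto simp: field_simps\<close>)
  also have "\<dots> \<le> (\<Prod>n\<in>J. exp 1 * R / cmod (z n))"
    by (rule prod_mono2[OF J sub]) (use zero_nonzero R in \<open>auto simp: J_def field_simps\<close>)
  also have "\<dots> \<le> exp A"
    unfolding J_def by (rule jensen(1)) (use R le in auto)
  finally show ?thesis by simp
qed

theorem sum_inverse_zeros:
  "((\<lambda>R. \<Sum>n\<in>{n\<in>I. cmod (z n) < R}. 1 / z n) \<longlongrightarrow> - deriv f 0) at_top"
proof (rule tendstoI)
  fix e :: real assume e: "e > 0"
  \<comment> \<open>The count, taken from the circle of radius \<open>exp 1 * R\<close>, costs
    \<open>exp 1 * \<delta>\<close>, the logarithmic derivative \<open>2 * \<delta>\<close>; the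
    total becomes \<open>e / 2\<close>.\<close>
  define \<delta> where "\<delta> = e / (2 * (exp 1 + 2))"
  have \<delta>: "\<delta> > 0" unfolding \<delta>_def using e by (simp add: add_pos_pos)
  obtain C where C: "\<And>w. cmod (f w) \<le> exp (\<delta> * cmod w + C)" using growth[OF \<delta>] by blast
  have bound: "cmod ((\<Sum>n\<in>{n\<in>I. cmod (z n) < R}. 1 / z n) + deriv f 0) \<le> e / 2 + 3 * \<bar>C\<bar> / R" if R: "R > 0" for R
  proof -
    have "cmod (f w) \<le> exp (\<delta> * R + \<bar>C\<bar>)" if "cmod w = R" for w
      using C[of w] that by (smt (verit) exp_le_cancel_iff)
    from jensen(2)[OF R this] have *: "cmod ((\<Sum>n\<in>{n\<in>I. cmod (z n) < R}. 1 / z n) + deriv f 0)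
      \<le> (real (card {n\<in>I. cmod (z n) < R}) + 2 * (\<delta> * R + \<bar>C\<bar>)) / R"
      .
    have "cmod (f w) \<le> exp (\<delta> * (exp 1 * R) + \<bar>C\<bar>)" if "cmod w \<le> exp 1 * R" for w
    proof -
      have "\<delta> * cmod w + C \<le> \<delta> * (exp 1 * R) + \<bar>C\<bar>" using that \<delta> by (intro add_mono mult_left_mono) auto
      then show ?thesis using C[of w] by (smt (verit) exp_le_cancel_iff)
    qed
    from count_le[OF R this]
    have "card {n\<in>I. cmod (z n) \<le> R} \<le> \<delta> * (exp 1 * R) + \<bar>C\<bar>" .
    moreover have "card {n\<in>I. cmod (z n) < R} \<le> card {n\<in>I. cmod (z n) \<le> R}"
      by (rule card_mono[OF finite_indices]) auto
    ultimately have "card {n\<in>I. cmod (z n) < R} + 2 * (\<delta> * R + \<bar>C\<bar>) \<le> (exp 1 + 2) * \<delta> * R + 3 * \<bar>C\<bar>"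
      by (simp add: algebra_simps)
    also have "(exp 1 + 2) * \<delta> = e / 2"
    proof -
      have "exp 1 + 2 \<noteq> (0::real)" using exp_gt_zero[of "1::real"] by linarith
      then show ?thesis unfolding \<delta>_def times_divide_eq_right 
        by (subst mult.commute[of 2]) (rule mult_divide_mult_cancel_left)
    qed
    finally have "(card {n\<in>I. cmod (z n) < R} + 2 * (\<delta> * R + \<bar>C\<bar>)) / R \<le> (e / 2 * R + 3 * \<bar>C\<bar>) / R"
      using R by (simp add: divide_right_mono)
    also have "\<dots> = e / 2 + 3 * \<bar>C\<bar> / R" using R by (simp add: field_simps)
    finally show ?thesis using * by linarith
  qed
  have "((\<lambda>R. e / 2 + 3 * \<bar>C\<bar> / R) \<longlongrightarrow> e / 2 + 0) at_top"
    by (intro tendsto_intros real_tendsto_divide_at_top[OF tendsto_const filterlim_ident])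
  then have "\<forall>\<^sub>F R in at_top. e / 2 + 3 * \<bar>C\<bar> / R < e"
    by (rule order_tendstoD) (use e in simp)
  with eventually_gt_at_top[of 0]
  show "\<forall>\<^sub>F R in at_top. dist (\<Sum>n\<in>{n\<in>I. cmod (z n) < R}. 1 / z n) (- deriv f 0) < e"
    by eventually_elim (use bound in \<open>fastforce simp: dist_norm\<close>)
qed

lemma count_linear:
  obtains C where "C \<ge> 0" "\<And>R. R > 0 \<Longrightarrow> real (card {n\<in>I. cmod (z n) \<le> R}) \<le> exp 1 * R + C"
proof -
  obtain C where C: "\<And>w. cmod (f w) \<le> exp (1 * cmod w + C)" using growth[of 1] by auto
  have "real (card {n\<in>I. cmod (z n) \<le> R}) \<le> exp 1 * R + \<bar>C\<bar>" if R: "R > 0" for R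
  proof (rule count_le[OF R])
    fix w :: complex assume "cmod w \<le> exp 1 * R"
    then show "cmod (f w) \<le> exp (exp 1 * R + \<bar>C\<bar>)"
      using C[of w] by (smt (verit) exp_le_cancel_iff)
  qed
  then show ?thesis using that[of "\<bar>C\<bar>"] by simp
qed

text \<open>Scaling by \<open>L\<close> moves all zeros out of the open unit disc, so that dyadic
  shells can be numbered from 0.\<close>

lemma zeros_away:
  obtains L where "L > 0" "\<And>n. n \<in> I \<Longrightarrow> 1 \<le> L * cmod (z n)"
proof -
  have "isCont f 0"
    using holo holomorphic_on_imp_continuous_on continuous_on_eq_continuous_at open_UNIV by blast
  then obtain r where r: "r > 0" "\<And>w. dist w 0 < r \<Longrightarrow> dist (f w) (f 0) < 1"
    unfolding continuous_at by (metis LIM_def dist_self zero_less_one)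
  have "r \<le> cmod (z n)" if "n \<in> I" for n
    using r(2)[of "z n"] zero[OF that] f_0 by (simp add: dist_norm not_less[symmetric]) blast
  then show ?thesis using that[of "1 / r"] r(1) by (simp add: field_simps)
qed

text \<open>Linear counting leaves at most \<open>K * 2 ^ j\<close> zeros in the dyadic shell
  \<open>j\<close>, and each contributes at most \<open>L powr p * (q / 2) ^ j\<close>. What remains
  is a geometric series with ratio \<open>q = 2 powr (- e)\<close>.\<close>

theorem summable_inverse_zeros:
  fixes e :: real
  assumes e: "e > 0"
  shows "(\<lambda>n. (1 / cmod (z n)) powr (1 + e)) summable_on I"
proof -
  obtain C where C: "C \<ge> 0" "\<And>R. R > 0 \<Longrightarrow> real (card {n\<in>I. cmod (z n) \<le> R}) \<le> exp 1 * R + C"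
    using count_linear by blast
  obtain L where L: "L > 0" "\<And>n. n \<in> I \<Longrightarrow> 1 \<le> L * cmod (z n)" using zeros_away by blast
  have "\<exists>k. 2 ^ k \<le> y \<and> y < 2 ^ Suc k" if "y \<ge> (1::real)" for y
  proof -
    define m where "m = (LEAST m. y < 2 ^ m)"
    have m: "y < 2 ^ m" unfolding m_def by (rule LeastI_ex) (rule real_arch_pow, simp)
    then have "m \<noteq> 0" using that by (intro notI) simp
    then obtain k where k: "m = Suc k" using not0_implies_Suc by blast
    then have "\<not> y < 2 ^ k" by (metis lessI m_def not_less_Least)
    then show ?thesis using m k by (intro exI[of _ k]) simp
  qed
  then have "\<exists>k. 2 ^ k \<le> L * cmod (z n) \<and> L * cmod (z n) < 2 ^ Suc k" if "n \<in> I" for n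
    using L(2)[OF that] by blast
  then obtain k where k: "\<And>n. n \<in> I \<Longrightarrow> 2 ^ k n \<le> L * cmod (z n)" "\<And>n. n \<in> I \<Longrightarrow> L * cmod (z n) < 2 ^ Suc (k n)"
    by metis
  define p where "p = 1 + e"
  define K where "K = 2 * exp 1 / L + C"
  define q where "q = (2::real) powr (- e)"
  have q: "0 < q" "q < 1" unfolding q_def using e by (auto simp: powr_less_one)
  have K: "K \<ge> 0" unfolding K_def using L(1) C(1) by simp
  have term_le: "(1 / cmod (z n)) powr p \<le> L powr p * (q / 2) ^ k n" if "n \<in> I" for n
  proof -
    have "cmod (z n) > 0" using zero_nonzero[OF that] by simp
    then have "1 / cmod (z n) \<le> L / 2 ^ k n" using k(1)[OF that] by (simp add: field_simps)
    then have "(1 / cmod (z n)) powr p \<le> (L / 2 ^ k n) powr p"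
      using e by (intro powr_mono2) (auto simp: p_def)
    also have "\<dots> = L powr p * (2 powr (- p)) ^ k n"
    proof -
      have "(2 ^ k n :: real) powr p = (2 powr p) ^ k n"
        by (simp add: powr_powr mult.commute flip: powr_realpow)
      then show ?thesis using L(1)
        by (simp add: powr_divide powr_minus_divide power_one_over divide_inverse[of "L powr p"] power_inverse inverse_eq_divide[symmetric])
    qed
    also have "2 powr (- p) = q / 2"
      by (simp add: p_def q_def powr_diff powr_minus_divide)
    finally show ?thesis .
  qed
  have card_le: "real (card {n\<in>F. k n = j}) \<le> K * 2 ^ j" if "F \<subseteq> I" for F j
  proof -
    have "real (card {n\<in>F. k n = j}) \<le> real (card {n\<in>I. cmod (z n) \<le> 2 ^ Suc j / L})"
      using that k(2) L(1) by (intro of_nat_mono card_mono finite_indices) (force simp: field_simps)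
    also have "\<dots> \<le> exp 1 * (2 ^ Suc j / L) + C" using L(1) by (intro C) simp
    also have "\<dots> \<le> exp 1 * (2 ^ Suc j / L) + C * 2 ^ j" 
      using mult_left_mono[OF one_le_power[of "2::real" j] C(1)] by simp
    also have "\<dots> = K * 2 ^ j" by (simp add: K_def algebra_simps)
    finally show ?thesis .
  qed
  have "(\<Sum>n\<in>F. (1 / cmod (z n)) powr p) \<le> (\<Sum>j. L powr p * K * q ^ j)" if F: "finite F" "F \<subseteq> I" for F
  proof -
    have "(\<Sum>n\<in>F. (1 / cmod (z n)) powr p) \<le> (\<Sum>n\<in>F. L powr p * (q / 2) ^ k n)"
      using term_le F by (intro sum_mono) auto
    also have "\<dots> = (\<Sum>j\<in>k ` F. \<Sum>n\<in>{n\<in>F. k n = j}. L powr p * (q / 2) ^ k n)"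
      by (rule sum.image_gen[OF F(1)])
    also have "\<dots> = (\<Sum>j\<in>k ` F. real (card {n\<in>F. k n = j}) * (L powr p * (q / 2) ^ j))"
      by (intro sum.cong refl) simp
    also have "\<dots> \<le> (\<Sum>j\<in>k ` F. (K * 2 ^ j) * (L powr p * (q / 2) ^ j))"
      using q by (intro sum_mono mult_right_mono card_le F) auto
    also have "\<dots> = (\<Sum>j\<in>k ` F. L powr p * K * q ^ j)"
      by (intro sum.cong refl) (simp add: power_divide)
    also have "\<dots> \<le> (\<Sum>j. L powr p * K * q ^ j)"
      using q K F by (intro sum_le_suminf summable_mult summable_geometric) auto
    finally show ?thesis .
  qed
  then show ?thesis unfolding p_def[symmetric]
    by (intro nonneg_bdd_above_summable_on bdd_aboveI2[where M = "\<Sum>j. L powr p * K * q ^ j"]) auto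
qed

text \<open>The cofactor \<open>Q\<close> of all zeros is zero-free of minimal type. On growing
  discs its logarithmic derivative is forced to 0, so \<open>Q\<close> is constant; then
  \<open>f\<close> grows like a power and Cauchy's estimates annihilate the higher
  derivatives.\<close>

theorem finite_zeros_imp_polynomial:
  assumes fin: "finite I"
  obtains N where "\<And>k. k > N \<Longrightarrow> (deriv ^^ k) f 0 = 0"
proof -
  obtain Q where Q: "Q holomorphic_on UNIV" and fQ: "\<And>w. f w = (\<Prod>n\<in>I. (w - z n)) * Q w"
    and Q0: "\<And>w. Q w = 0 \<Longrightarrow> f w = 0 \<and> w \<notin> z ` I"
    using factor[OF fin] by auto
  have nz: "Q w \<noteq> 0" for w using Q0 zero_in_range by blast
  define \<rho> where "\<rho> = (\<Sum>n\<in>I. cmod (z n))"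
  have \<rho>: "cmod (z n) \<le> \<rho>" if "n \<in> I" for n
    unfolding \<rho>_def using fin that by (intro member_le_sum) auto
  have \<rho>0: "\<rho> \<ge> 0" unfolding \<rho>_def by (simp add: sum_nonneg)
  \<comment> \<open>Outside this radius every linear factor has modulus at least 1, so
    \<open>Q\<close> inherits the growth of \<open>f\<close>; the inner region is left to the
    maximum principle.\<close>
  have Q_le: "cmod (Q w) \<le> cmod (f w)" if "cmod w \<ge> \<rho> + 1" for w
  proof -
    have "1 \<le> (\<Prod>n\<in>I. cmod (w - z n))"
    proof (rule prod_ge_1)
      fix n assume "n \<in> I"
      then show "1 \<le> cmod (w - z n)" using \<rho>[of n] that norm_triangle_ineq2[of w "z n"] by linarith
    qed
    then show ?thesis unfolding fQ[of w] norm_mult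
      by (simp add: prod_norm mult_left_le_one_le[of "cmod (Q w)"] mult_le_cancel_right1)
  qed
  have "deriv Q c = 0" for c
  proof -
    \<comment> \<open>Large \<open>R\<close> leaves \<open>2 * \<delta>\<close>, and minimal type
      lets \<open>\<delta>\<close> tend to 0 afterwards.\<close>
    have "cmod (deriv Q c / Q c) \<le> 2 * \<delta>" if \<delta>: "\<delta> > 0" for \<delta>
    proof -
      obtain C where C: "\<And>w. cmod (f w) \<le> exp (\<delta> * cmod w + C)" using growth[OF \<delta>] by blast
      define a where "a = \<delta> * cmod c + C - ln (cmod (Q c))"
      have bound: "cmod (deriv Q c / Q c) \<le> 2 * \<delta> + 2 * a / R" if R: "R > \<rho> + 1 + cmod c" for R
      proof -
        have R0: "R > 0" using R \<rho>0 norm_ge_zero[of c] by linarith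
        have sphere: "cmod (Q w) \<le> exp (\<delta> * (R + cmod c) + C)" if "cmod (w - c) = R" for w
        proof -
          have w: "cmod w \<ge> \<rho> + 1" "cmod w \<le> R + cmod c"
            using that R norm_triangle_ineq2[of w c] norm_triangle_ineq4[of w c] norm_triangle_sub[of w c]
            by linarith+
          have "cmod (Q w) \<le> exp (\<delta> * cmod w + C)" using Q_le[OF w(1)] C[of w] by linarith
          also have "\<dots> \<le> exp (\<delta> * (R + cmod c) + C)" using w(2) \<delta> by simp
          finally show ?thesis .
        qed
        have "cmod (Q w) \<le> exp (\<delta> * (R + cmod c) + C)" if "w \<in> ball c R" for w
        proof (rule maximum_modulus_frontier[of Q "cball c R"])
          show "Q holomorphic_on interior (cball c R)" using Q holomorphic_on_subset by blast
          show "continuous_on (closure (cball c R)) Q"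
            using Q holomorphic_on_imp_continuous_on holomorphic_on_subset by blast
        qed (use that sphere in \<open>auto simp: frontier_cball dist_norm norm_minus_commute\<close>)
        then have "cmod (deriv Q c / Q c) \<le> 2 * (\<delta> * (R + cmod c) + C - ln (cmod (Q c))) / R"
          by (intro logderiv_le) (use Q R0 nz holomorphic_on_subset in auto)
        also have "\<dots> = 2 * \<delta> + 2 * a / R" using R0 by (simp add: a_def field_simps)
        finally show ?thesis .
      qed
      have "((\<lambda>R. 2 * \<delta> + 2 * a / R) \<longlongrightarrow> 2 * \<delta> + 0) at_top"
        by (intro tendsto_intros real_tendsto_divide_at_top[OF tendsto_const filterlim_ident])
      moreover have "\<forall>\<^sub>F R in at_top. cmod (deriv Q c / Q c) \<le> 2 * \<delta> + 2 * a / R"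
        using eventually_gt_at_top[of "\<rho> + 1 + cmod c"] by eventually_elim (rule bound)
      ultimately show ?thesis
        using tendsto_lowerbound[of "\<lambda>R. 2 * \<delta> + 2 * a / R" "2 * \<delta> + 0" at_top] by simp
    qed
    then have "cmod (deriv Q c / Q c) / 2 \<le> \<delta>" if "\<delta> > 0" for \<delta>
      using that by (fastforce simp: field_simps)
    then have "cmod (deriv Q c / Q c) / 2 \<le> 0" by (rule dense_ge)
    then show ?thesis using nz by simp
  qed
  then have "(Q has_field_derivative 0) (at w)" for w
    using holomorphic_derivI[OF Q open_UNIV UNIV_I, of w] by simp
  then obtain b where b: "\<And>w. Q w = b"
    using DERIV_zero_connected_constant[of UNIV "{}" Q] Q holomorphic_on_imp_continuous_on by auto
  define N where "N = card I"
  have "(deriv ^^ k) f 0 = 0" if k: "k > N" for k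
  proof -
    have bound: "cmod ((deriv ^^ k) f 0) \<le> fact k * cmod b * 2 ^ N / R" if R: "R \<ge> \<rho> + 1" for R
    proof -
      have R0: "R \<ge> 1" using R \<rho>0 by simp
      have "cmod (f w) \<le> cmod b * (2 * R) ^ N" if "cmod w = R" for w
      proof -
        have "(\<Prod>n\<in>I. cmod (w - z n)) \<le> (\<Prod>n\<in>I. 2 * R)"
        proof (intro prod_mono conjI norm_ge_zero)
          show "cmod (w - z n) \<le> 2 * R" if "n \<in> I" for n
            using norm_triangle_ineq4[of w "z n"] \<rho>[OF that] \<open>cmod w = R\<close> R by linarith
        qed
        then show ?thesis unfolding fQ[of w] b norm_mult N_def prod_norm[symmetric]
          by (simp add: mult.commute[of "cmod b"] mult_right_mono)
      qed
      then have "cmod ((deriv ^^ k) f 0) \<le> fact k * (cmod b * (2 * R) ^ N) / R ^ k"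
      proof (intro Cauchy_inequality)
        show "f holomorphic_on ball 0 R" using holo holomorphic_on_subset by blast
        show "continuous_on (cball 0 R) f"
          using holo holomorphic_on_imp_continuous_on holomorphic_on_subset by blast
      qed (use R0 in auto)
      also have "\<dots> = fact k * cmod b * 2 ^ N * (R ^ N / R ^ k)"
        by (simp add: power_mult_distrib)
      also have "\<dots> \<le> fact k * cmod b * 2 ^ N * (1 / R)"
      proof (intro mult_left_mono)
        have "R ^ N * R \<le> R ^ k" using k R0 power_increasing[of "Suc N" k R] by (simp add: mult.commute)
        then show "R ^ N / R ^ k \<le> 1 / R" using R0 by (simp add: field_simps)
      qed simp
      finally show ?thesis by simp
    qed
    have "((\<lambda>R. fact k * cmod b * 2 ^ N / R) \<longlongrightarrow> 0) at_top"
      by (intro real_tendsto_divide_at_top[OF tendsto_const filterlim_ident])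
    moreover have "\<forall>\<^sub>F R in at_top. cmod ((deriv ^^ k) f 0) \<le> fact k * cmod b * 2 ^ N / R"
      using eventually_ge_at_top[of "\<rho> + 1"] by eventually_elim (rule bound)
    ultimately have "cmod ((deriv ^^ k) f 0) \<le> 0"
      by (rule tendsto_lowerbound) simp
    then show ?thesis by simp
  qed
  then show ?thesis using that by blast
qed

end

section \<open>The Fredholm determinant\<close>

text \<open>The weights \<open>P n y\<close> are at most \<open>1 / fact n\<close>, so geometric
  growth of the coefficients gives uniform convergence, and it is preserved by the shift that
  accompanies integration.\<close>

definition exp_bounded :: "(nat \<Rightarrow> 'a::real_normed_vector) \<Rightarrow> bool" where
  "exp_bounded c \<longleftrightarrow> (\<exists>B K. 0 \<le> B \<and> 0 \<le> K \<and> (\<forall>n. norm (c n) \<le> B * K ^ n))"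

lemma exp_bounded_Suc: "exp_bounded c \<Longrightarrow> exp_bounded (\<lambda>n. c (Suc n))"
  unfolding exp_bounded_def
proof (elim exE conjE)
  fix B K :: real assume "0 \<le> B" "0 \<le> K" "\<forall>n. norm (c n) \<le> B * K ^ n"
  moreover from this(3) have "norm (c (Suc n)) \<le> (B * K) * K ^ n" for n
    by (metis mult.assoc power_Suc)
  ultimately show "\<exists>B K. 0 \<le> B \<and> 0 \<le> K \<and> (\<forall>n. norm (c (Suc n)) \<le> B * K ^ n)"
    by (intro exI[of _ "B * K"] exI[of _ K]) simp
qed

lemma integral_power_tail:
  fixes y :: real
  assumes "y \<le> 1"
  shows "((\<lambda>t. (1 - t) ^ n / fact n) has_integral (1 - y) ^ Suc n / fact (Suc n)) {y..1}"
proof -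
  have "((\<lambda>t. (1 - t) ^ n / fact n) has_integral
      (- ((1 - 1) ^ Suc n / fact (Suc n)) - (- ((1 - y) ^ Suc n / fact (Suc n))))) {y..1}"
  proof (rule fundamental_theorem_of_calculus[OF assms])
    fix t :: real
    have "((\<lambda>t. - ((1 - t) ^ Suc n / fact (Suc n))) has_real_derivative (1 - t) ^ n / fact n) (at t within {y..1})"
    proof -
      have "((\<lambda>t. (1 - t) ^ Suc n) has_real_derivative - (real (Suc n) * (1 - t) ^ n)) (at t within {y..1})"
        using DERIV_power[of "\<lambda>t. 1 - t" "-1" t "{y..1}" "Suc n"]
        by (auto intro!: derivative_eq_intros simp del: power_Suc)
      then have "((\<lambda>t. - ((1 - t) ^ Suc n / fact (Suc n))) has_real_derivative
          - (- (real (Suc n) * (1 - t) ^ n) / fact (Suc n))) (at t within {y..1})"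
        by (intro DERIV_minus DERIV_cdivide)
      then show ?thesis by (simp only: fact_Suc of_nat_mult) simp
    qed
    then show "((\<lambda>t. - ((1 - t) ^ Suc n / fact (Suc n))) has_vector_derivative (1 - t) ^ n / fact n) (at t within {y..1})"
      by (simp add: has_real_derivative_iff_has_vector_derivative)
  qed
  then show ?thesis by simp
qed

locale volterra_composition =
  fixes \<phi> :: "real \<Rightarrow> real"
  assumes range: "\<forall>x\<in>{0..1}. \<phi> x \<in> {0..1}"
    and mono: "mono_on {0..1} \<phi>"
    and cont: "continuous_on {0..1} \<phi>"
    and above: "\<forall>x\<in>{0<..<1}. \<phi> x > x"
begin

lemma phi_in [simp]: "0 \<le> x \<Longrightarrow> x \<le> 1 \<Longrightarrow> 0 \<le> \<phi> x" "0 \<le> x \<Longrightarrow> x \<le> 1 \<Longrightarrow> \<phi> x \<le> 1"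
  using range by auto

lemma phi_mono: "0 \<le> x \<Longrightarrow> x \<le> y \<Longrightarrow> y \<le> 1 \<Longrightarrow> \<phi> x \<le> \<phi> y"
  using mono by (auto simp: mono_on_def)

lemma phi_1: "\<phi> 1 = 1"
proof -
  have "x \<le> \<phi> 1" if "0 < x" "x < 1" for x
    using above phi_mono[of x 1] that by force
  then have "1 \<le> \<phi> 1" using dense_le_bounded[of 0 1 "\<phi> 1"] by simp
  moreover have "\<phi> 1 \<le> 1" by simp
  ultimately show ?thesis by (rule antisym[rotated])
qed

lemma phi_ge:
  assumes "0 \<le> x" "x \<le> 1"
  shows "x \<le> \<phi> x"
proof -
  consider "x = 0" | "x = 1" | "x \<in> {0<..<1}" using assms by fastforce
  then show ?thesis
  proof cases
    case 3
    then have "x < \<phi> x" using above by blast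
    then show ?thesis by simp
  qed (use phi_1 phi_in(1)[of 0] in auto)
qed

lemma continuous_on_compose_phi:
  assumes "continuous_on {0..1} f" "0 \<le> a"  "b \<le> 1"
  shows "continuous_on {a..b} (\<lambda>t. f (\<phi> t))"
  by (rule continuous_on_subset[OF continuous_on_compose2[OF assms(1) cont]]) (use range assms in auto)

text \<open>\<open>P n y\<close> is the volume of the chains \<open>y < x\<^sub>1\<close>, \<open>\<phi> x\<^sub>i < x\<^bsub>i+1\<^esub>\<close>, \<open>x\<^sub>n < 1\<close>. The numbers \<open>P n 0\<close> are,
  up to sign, the coefficients of the Fredholm determinant of \<open>V\<^sub>\<phi>\<close>.\<close>

primrec P :: "nat \<Rightarrow> real \<Rightarrow> real" where
  "P 0 y = 1"
| "P (Suc n) y = integral {y..1} (\<lambda>t. P n (\<phi> t))"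

declare P.simps(2) [simp del]

lemma continuous_on_P: "continuous_on {0..1} (P n)"
proof (induction n)
  case (Suc n)
  have "(\<lambda>t. P n (\<phi> t)) integrable_on {0..1}"
    by (intro integrable_continuous_real continuous_on_compose_phi[OF Suc]) auto
  from indefinite_integral_continuous_1'[OF this] show ?case by (simp add: P.simps(2)[abs_def])
qed simp

lemma continuous_on_P_phi: "0 \<le> a \<Longrightarrow> b \<le> 1 \<Longrightarrow> continuous_on {a..b} (\<lambda>t. P n (\<phi> t))"
  by (rule continuous_on_compose_phi[OF continuous_on_P])

lemma integrable_P_phi: "0 \<le> a \<Longrightarrow> b \<le> 1 \<Longrightarrow> (\<lambda>t. P n (\<phi> t)) integrable_on {a..b}"
  by (intro integrable_continuous_real continuous_on_P_phi)

lemma P_nonneg: "0 \<le> y \<Longrightarrow> y \<le> 1 \<Longrightarrow> 0 \<le> P n y"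
proof (induction n arbitrary: y)
  case (Suc n)
  then show ?case unfolding P.simps by (auto intro!: integral_nonneg integrable_P_phi)
qed simp

text \<open>Since \<open>\<phi> x \<ge> x\<close>, the chains are increasing; the bound is the
  volume of the simplex of increasing \<open>n\<close>-tuples in \<open>[y, 1]\<close>.\<close>

lemma P_le: "0 \<le> y \<Longrightarrow> y \<le> 1 \<Longrightarrow> P n y \<le> (1 - y) ^ n / fact n"
proof (induction n arbitrary: y)
  case (Suc n)
  have "P (Suc n) y \<le> integral {y..1} (\<lambda>t. (1 - t) ^ n / fact n)"
    unfolding P.simps
  proof (rule integral_le)
    show "(\<lambda>t. (1 - t) ^ n / fact n) integrable_on {y..1}"
      using integral_power_tail[OF Suc.prems(2)] by blast
    fix t assume t: "t \<in> {y..1}"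
    have "P n (\<phi> t) \<le> (1 - \<phi> t) ^ n / fact n" using t Suc.prems by (intro Suc.IH) auto
    also have "\<dots> \<le> (1 - t) ^ n / fact n"
      using t Suc.prems phi_ge[of t] by (intro divide_right_mono power_mono) auto
    finally show "P n (\<phi> t) \<le> (1 - t) ^ n / fact n" .
  qed (use Suc.prems in \<open>auto intro: integrable_P_phi\<close>)
  also have "\<dots> = (1 - y) ^ Suc n / fact (Suc n)"
    using integral_power_tail[OF Suc.prems(2)] by (rule integral_unique)
  finally show ?case .
qed simp

lemma P_le_fact: "0 \<le> y \<Longrightarrow> y \<le> 1 \<Longrightarrow> P n y \<le> 1 / fact n"
  by (rule order.trans[OF P_le]) (auto simp: divide_right_mono power_le_one)

lemma P_antimono:
  assumes "0 \<le> x" "x \<le> y" "y \<le> 1"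
  shows "P n y \<le> P n x"
proof (cases n)
  case (Suc k)
  have "integral {y..1} (\<lambda>t. P k (\<phi> t)) \<le> integral {x..1} (\<lambda>t. P k (\<phi> t))"
    by (rule integral_subset_le) (use assms in \<open>auto intro: integrable_P_phi P_nonneg\<close>)
  then show ?thesis by (simp add: Suc P.simps(2))
qed simp

text \<open>One construction with two uses: real coefficients \<open>r ^ n\<close> give the majorant
  \<open>p r\<close>, complex coefficients \<open>taylor_coeff z j\<close> give the determinant and
  the functions e_z with their Taylor coefficients in z.\<close>

definition S :: "(nat \<Rightarrow> 'a::euclidean_space) \<Rightarrow> real \<Rightarrow> 'a" where
  "S c y = (\<Sum>n. P n y *\<^sub>R c n)"

lemma S_bound:
  fixes c :: "nat \<Rightarrow> 'a::euclidean_space"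
  assumes "exp_bounded c"
  obtains M where "summable M" "\<And>n y. y \<in> {0..1} \<Longrightarrow> norm (P n y *\<^sub>R c n) \<le> M n"
proof -
  obtain B K where BK: "0 \<le> B" "0 \<le> K" "\<And>n. norm (c n) \<le> B * K ^ n"
    using assms unfolding exp_bounded_def by blast
  show ?thesis
  proof (rule that)
    show "summable (\<lambda>n. B * (inverse (fact n) * K ^ n))"
      by (intro summable_mult summable_exp)
    fix n :: nat and y :: real assume "y \<in> {0..1}"
    then have "\<bar>P n y\<bar> * norm (c n) \<le> inverse (fact n) * (B * K ^ n)"
      using P_nonneg[of y n] P_le_fact[of y n] BK by (intro mult_mono) (auto simp: inverse_eq_divide)
    then show "norm (P n y *\<^sub>R c n) \<le> B * (inverse (fact n) * K ^ n)" by (simp add: ac_simps)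
  qed
qed

lemma summable_S_norm:
  fixes c :: "nat \<Rightarrow> 'a::euclidean_space"
  assumes "exp_bounded c" "0 \<le> y" "y \<le> 1"
  shows "summable (\<lambda>n. norm (P n y *\<^sub>R c n))"
proof -
  obtain M where M: "summable M" "\<And>n y. y \<in> {0..1} \<Longrightarrow> norm (P n y *\<^sub>R c n) \<le> M n"
    using S_bound[OF assms(1)] by blast
  show ?thesis
    by (rule summable_comparison_test'[OF M(1)]) (use M(2) assms in auto)
qed

lemmas summable_S = summable_S_norm[THEN summable_norm_cancel]

lemma uniform_limit_S:
  fixes c :: "nat \<Rightarrow> 'a::euclidean_space"
  assumes "exp_bounded c"
  shows "uniform_limit {0..1} (\<lambda>N y. \<Sum>n<N. P n y *\<^sub>R c n) (S c) sequentially"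
proof -
  obtain M where M: "summable M" "\<And>n y. y \<in> {0..1} \<Longrightarrow> norm (P n y *\<^sub>R c n) \<le> M n"
    using S_bound[OF assms(1)] by blast
  have "uniform_limit {0..1} (\<lambda>N y. \<Sum>n<N. P n y *\<^sub>R c n) (\<lambda>y. \<Sum>n. P n y *\<^sub>R c n) sequentially"
    by (rule Weierstrass_m_test[OF M(2,1)])
  then show ?thesis by (simp add: S_def[abs_def])
qed

lemma continuous_on_S:
  fixes c :: "nat \<Rightarrow> 'a::euclidean_space"
  assumes "exp_bounded c"
  shows "continuous_on {0..1} (S c)"
proof (rule uniform_limit_theorem[OF _ uniform_limit_S[OF assms]])
  have "continuous_on {0..1} (\<lambda>y. \<Sum>n<N. P n y *\<^sub>R c n)" for N
    by (intro continuous_intros continuous_on_P)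
  then show "\<forall>\<^sub>F N in sequentially. continuous_on {0..1} (\<lambda>y. \<Sum>n<N. P n y *\<^sub>R c n)" by simp
qed simp

text \<open>The recursion of \<open>P\<close>, summed termwise; uniform convergence permits the
  exchange with the integral. Composing with \<open>\<phi>\<close> and integrating thus acts as a
  shift of coefficients.\<close>

lemma S_rec:
  fixes c :: "nat \<Rightarrow> 'a::euclidean_space"
  assumes c: "exp_bounded c" and y: "0 \<le> y" "y \<le> 1"
  shows "S c y = c 0 + integral {y..1} (\<lambda>t. S (\<lambda>n. c (Suc n)) (\<phi> t))"
proof -
  define f where "f N t = (\<Sum>n<N. P n (\<phi> t) *\<^sub>R c (Suc n))" for N t
  have "uniform_limit {y..1} f (\<lambda>t. S (\<lambda>n. c (Suc n)) (\<phi> t)) sequentially"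
    unfolding f_def
    by (rule uniform_limit_compose'[OF uniform_limit_S[OF exp_bounded_Suc[OF c]]]) (use y in auto)
  moreover have f: "continuous_on {y..1} (f N)" for N
    unfolding f_def using y by (auto intro!: continuous_intros continuous_on_P_phi)
  ultimately obtain I J where I: "\<And>N. (f N has_integral I N) {y..1}"
    and J: "((\<lambda>t. S (\<lambda>n. c (Suc n)) (\<phi> t)) has_integral J) {y..1}" and lim: "I \<longlonglongrightarrow> J"
    using uniform_limit_integral[where f = f and F = sequentially] sequentially_bot by metis
  have "I N = (\<Sum>n<N. P (Suc n) y *\<^sub>R c (Suc n))" for N
  proof -
    have "(f N has_integral (\<Sum>n<N. P (Suc n) y *\<^sub>R c (Suc n))) {y..1}"
      unfolding f_def P.simps
      by (intro has_integral_sum has_integral_scaleR_left integrable_integral integrable_P_phi) (use y in auto)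
    then show ?thesis using I has_integral_unique by blast
  qed
  then have "(\<lambda>n. P (Suc n) y *\<^sub>R c (Suc n)) sums J" using lim unfolding sums_def by presburger
  then have "(\<Sum>n. P (Suc n) y *\<^sub>R c (Suc n)) = J" by (simp add: sums_iff)
  moreover have "J = integral {y..1} (\<lambda>t. S (\<lambda>n. c (Suc n)) (\<phi> t))"
    using J by (simp add: integral_unique)
  moreover have "S c y = c 0 + (\<Sum>n. P (Suc n) y *\<^sub>R c (Suc n))"
    unfolding S_def using suminf_split_head[OF summable_S[OF c y]] by simp
  ultimately show ?thesis by simp
qed

lemma integrable_S_phi:
  fixes c :: "nat \<Rightarrow> 'a::euclidean_space"
  assumes "exp_bounded c" "0 \<le> a" "b \<le> 1"
  shows "(\<lambda>t. S c (\<phi> t)) integrable_on {a..b}"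
  by (rule integrable_continuous_real[OF continuous_on_compose_phi[OF continuous_on_S[OF assms(1)] assms(2,3)]])

lemma S_diff:
  fixes c :: "nat \<Rightarrow> 'a::euclidean_space"
  assumes c: "exp_bounded c" and y: "0 \<le> x" "x \<le> y" "y \<le> 1"
  shows "S c x = S c y + integral {x..y} (\<lambda>t. S (\<lambda>n. c (Suc n)) (\<phi> t))"
proof -
  let ?f = "\<lambda>t. S (\<lambda>n. c (Suc n)) (\<phi> t)"
  have "integral {x..y} ?f + integral {y..1} ?f = integral {x..1} ?f"
    by (rule Henstock_Kurzweil_Integration.integral_combine[OF y(2,3) integrable_S_phi[OF exp_bounded_Suc[OF c] y(1) order.refl]])
  moreover have "S c x = c 0 + integral {x..1} ?f" "S c y = c 0 + integral {y..1} ?f"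
    by (rule S_rec[OF c]; use y in simp)+
  ultimately have "S c x = c 0 + (integral {x..y} ?f + integral {y..1} ?f)"
    "S c y = c 0 + integral {y..1} ?f" by (simp_all only:)
  then show ?thesis by (simp only: ac_simps)
qed

lemma S_scale:
  fixes c :: "nat \<Rightarrow> 'a::{euclidean_space, real_normed_algebra}"
  assumes "exp_bounded c" "0 \<le> y" "y \<le> 1"
  shows "S (\<lambda>n. a * c n) y = a * S c y"
  unfolding S_def using suminf_mult[OF summable_S[OF assms], of a] by simp

subsection \<open>Growth of the determinant\<close>

text \<open>For \<open>r \<ge> 0\<close>, \<open>p r 0\<close> is \<open>D (- r)\<close>, the
  maximum of \<open>cmod D\<close> on the circle of radius \<open>r\<close>, because the signs of
  the coefficients of \<open>D\<close> alternate. With a variable base point it solves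
  \<open>p' = - r * p(\<phi>)\<close>, which makes its growth accessible.\<close>

definition p :: "real \<Rightarrow> real \<Rightarrow> real" where
  "p r = S (\<lambda>n. r ^ n)"

lemma exp_bounded_power: "exp_bounded (\<lambda>n. (z::'a::real_normed_div_algebra) ^ n)"
  unfolding exp_bounded_def by (intro exI[of _ 1] exI[of _ "norm z"]) (auto simp: norm_power)

lemma p_diff:
  assumes "0 \<le> x" "x \<le> y" "y \<le> 1"
  shows "p r x = p r y + r * integral {x..y} (\<lambda>t. p r (\<phi> t))"
proof -
  have "integral {x..y} (\<lambda>t. S (\<lambda>n. r ^ Suc n) (\<phi> t)) = integral {x..y} (\<lambda>t. r * p r (\<phi> t))"
    by (rule integral_cong) (use assms in \<open>simp add: p_def S_scale exp_bounded_power\<close>)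
  then show ?thesis
    unfolding p_def using S_diff[OF exp_bounded_power assms, of r] by (simp add: p_def)
qed

lemma p_1: "p r 1 = 1"
  using S_rec[OF exp_bounded_power, of 1 r] unfolding p_def by simp

lemma continuous_on_p: "continuous_on {0..1} (p r)"
  unfolding p_def by (rule continuous_on_S[OF exp_bounded_power])

lemma p_ge_1: "r \<ge> 0 \<Longrightarrow> 0 \<le> y \<Longrightarrow> y \<le> 1 \<Longrightarrow> 1 \<le> p r y"
  unfolding p_def S_def
  using sum_le_suminf[OF summable_S[OF exp_bounded_power], of y "{0}" r] by (simp add: P_nonneg)

lemma p_antimono: "r \<ge> 0 \<Longrightarrow> 0 \<le> x \<Longrightarrow> x \<le> y \<Longrightarrow> y \<le> 1 \<Longrightarrow> p r y \<le> p r x"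
  unfolding p_def S_def
  by (intro suminf_le summable_S exp_bounded_power scaleR_right_mono P_antimono) auto

text \<open>A Gronwall argument: \<open>p r\<close> decreases and \<open>\<phi> t \<ge> t\<close>,
  so \<open>exp (r * t) * p r t\<close> is nondecreasing. It serves near the endpoints, where
  \<open>\<phi>\<close> may touch the diagonal.\<close>

lemma p_exp_le:
  assumes r: "r \<ge> 0" and xy: "0 \<le> x" "x \<le> y" "y \<le> 1"
  shows "p r x \<le> exp (r * (y - x)) * p r y"
proof -
  \<comment> \<open>\<open>p r\<close> enters through its integral form, whose derivative the
    fundamental theorem supplies.\<close>
  define F where "F t = exp (r * t) * (p r x - r * integral {x..t} (\<lambda>t. p r (\<phi> t)))" for t
  have p_eq: "p r t = p r x - r * integral {x..t} (\<lambda>t. p r (\<phi> t))" if "t \<in> {x..y}" for t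
    using p_diff[of x t r] that xy by simp
  have cont_p: "continuous_on {x..y} (\<lambda>t. p r (\<phi> t))"
    by (rule continuous_on_compose_phi[OF continuous_on_p]) (use xy in auto)
  have "F x \<le> F y"
  proof (rule DERIV_nonneg_imp_increasing_open[OF xy(2)])
    fix t assume t: "x < t" "t < y"
    have "((\<lambda>t. integral {x..t} (\<lambda>t. p r (\<phi> t))) has_real_derivative p r (\<phi> t)) (at t within {x..y})"
      by (rule integral_has_real_derivative[OF cont_p]) (use t in auto)
    then have d: "((\<lambda>t. integral {x..t} (\<lambda>t. p r (\<phi> t))) has_real_derivative p r (\<phi> t)) (at t)"
      using t at_within_Icc_at[of x t y] by simp
    have "(F has_real_derivative (r * exp (r * t) * (p r t - p r (\<phi> t)))) (at t)"
    proof -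
      have "((\<lambda>t. exp (r * t)) has_real_derivative r * exp (r * t)) (at t)"
        by (auto intro!: derivative_eq_intros)
      moreover have "((\<lambda>t. p r x - r * integral {x..t} (\<lambda>t. p r (\<phi> t))) has_real_derivative 0 - r * p r (\<phi> t)) (at t)"
        by (intro DERIV_diff DERIV_const DERIV_cmult d)
      ultimately have "(F has_real_derivative r * exp (r * t) * (p r x - r * integral {x..t} (\<lambda>t. p r (\<phi> t)))
          + (0 - r * p r (\<phi> t)) * exp (r * t)) (at t)"
        unfolding F_def by (rule DERIV_mult)
      moreover have "p r x - r * integral {x..t} (\<lambda>t. p r (\<phi> t)) = p r t" using p_eq[of t] t by simp
      ultimately show ?thesis by (simp add: algebra_simps)
    qed
    moreover have "p r (\<phi> t) \<le> p r t" using t xy r phi_ge[of t] by (intro p_antimono) auto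
    ultimately show "\<exists>d. DERIV F t :> d \<and> 0 \<le> d" using r by fastforce
  next
    show "continuous_on {x..y} F"
      unfolding F_def
      by (intro continuous_intros indefinite_integral_continuous_1 integrable_continuous_real cont_p)
  qed
  then have "exp (r * x) * p r x \<le> exp (r * y) * p r y" using p_eq[of y] xy by (simp add: F_def)
  then show ?thesis by (simp add: right_diff_distrib exp_diff field_simps)
qed

text \<open>On \<open>[x, y]\<close> the values of \<open>\<phi>\<close> are at least
  \<open>\<phi> x \<ge> y\<close>, so the integrand never exceeds \<open>p r y\<close>: going back
  from \<open>y\<close> to \<open>x\<close> costs a factor linear in \<open>r\<close>, not an
  exponential one.\<close>

lemma p_jump_le:
  assumes r: "r \<ge> 0" and xy: "0 \<le> x" "x \<le> y" "y \<le> 1" "y \<le> \<phi> x"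
  shows "p r x \<le> (1 + r) * p r y"
proof -
  have "integral {x..y} (\<lambda>t. p r (\<phi> t)) \<le> integral {x..y} (\<lambda>t. p r y)"
  proof (rule integral_le)
    show "(\<lambda>t. p r (\<phi> t)) integrable_on {x..y}"
      by (intro integrable_continuous_real continuous_on_compose_phi[OF continuous_on_p]) (use xy in auto)
    fix t assume "t \<in> {x..y}"
    then show "p r (\<phi> t) \<le> p r y"
      using xy r phi_mono[of x t] by (intro p_antimono) auto
  qed (rule integrable_const_ivl)
  also have "\<dots> \<le> 1 * p r y"
    using xy p_ge_1[OF r, of y] by (simp add: mult_right_mono[of "y - x" 1])
  finally have "r * integral {x..y} (\<lambda>t. p r (\<phi> t)) \<le> r * p r y" using r by (simp add: mult_left_mono)
  then show ?thesis using p_diff[OF xy(1-3), of r] by (simp add: algebra_simps)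
qed

lemma phi_gap:
  assumes "0 \<le> a" "a \<le> b" "b \<le> 1" "\<And>x. x \<in> {a..b} \<Longrightarrow> x < \<phi> x"
  obtains \<eta> where "\<eta> > 0" "\<And>x. x \<in> {a..b} \<Longrightarrow> x + \<eta> \<le> \<phi> x"
proof -
  have "continuous_on {a..b} (\<lambda>x. \<phi> x - x)"
    by (intro continuous_intros continuous_on_subset[OF cont]) (use assms in auto)
  then obtain x0 where x0: "x0 \<in> {a..b}" "\<And>x. x \<in> {a..b} \<Longrightarrow> \<phi> x0 - x0 \<le> \<phi> x - x"
    using continuous_attains_inf[of "{a..b}" "\<lambda>x. \<phi> x - x"] assms(2) by auto
  then show ?thesis using that[of "\<phi> x0 - x0"] assms(4)[of x0] by force
qed

text \<open>The exponential price is paid only on \<open>[0, d]\<close> and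
  \<open>[1 - d, 1]\<close>. In between, \<open>K\<close> jumps of length \<open>\<eta>\<close>
  suffice, with \<open>K\<close> independent of \<open>r\<close>, and \<open>(1 + r) ^ K\<close>
  lies below every exponential up to a constant.\<close>

lemma p_growth:
  assumes \<delta>: "\<delta> > 0"
  obtains C where "\<And>r. r \<ge> 0 \<Longrightarrow> p r 0 \<le> exp (\<delta> * r + C)"
proof -
  \<comment> \<open>Each end interval puts \<open>d * r\<close> into the exponent, and the power
    \<open>(1 + r) ^ K\<close> will add \<open>K * s * r \<le> d * r\<close>; hence a third of
    \<open>\<delta>\<close>. The cap \<open>1 / 4\<close> ensures
    \<open>d \<le> 1 - d\<close>.\<close>
  define d where "d = min (\<delta> / 3) (1 / 4)"
  have d: "0 < d" "d \<le> \<delta> / 3" "d \<le> 1 - d" unfolding d_def using \<delta> by auto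
  obtain \<eta> where \<eta>: "\<eta> > 0" "\<And>x. x \<in> {d..1-d} \<Longrightarrow> x + \<eta> \<le> \<phi> x"
    using phi_gap[of d "1 - d"] d above by auto
  obtain K :: nat where K: "1 / \<eta> < K" using reals_Archimedean2 by blast
  have step: "p r x \<le> (1 + r) ^ k * p r (1 - d)"
    if "r \<ge> 0" "x \<in> {d..1-d}" "1 - d - k * \<eta> \<le> x" for r x k
    using that
  proof (induction k arbitrary: x)
    case (Suc k)
    define y where "y = min (x + \<eta>) (1 - d)"
    have y: "x \<le> y" "y \<in> {d..1-d}" "1 - d - k * \<eta> \<le> y" "y \<le> \<phi> x"
      using Suc.prems \<eta>(1) \<eta>(2)[of x] by (auto simp: y_def algebra_simps)
    have "p r x \<le> (1 + r) * p r y"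
      by (rule p_jump_le) (use y Suc.prems d in auto)
    also have "\<dots> \<le> (1 + r) * ((1 + r) ^ k * p r (1 - d))"
      using Suc.prems y by (intro mult_left_mono Suc.IH) auto
    finally show ?case by simp
  qed simp
  define s where "s = d / (K + 1)"
  have s: "s > 0" unfolding s_def using d by simp
  have sK: "K * s \<le> d" unfolding s_def using d by (simp add: field_simps)
  have "p r 0 \<le> exp (\<delta> * r + K * ln (1 + 1 / s))" if r: "r \<ge> 0" for r
  proof -
    have "p r 0 \<le> exp (r * (d - 0)) * p r d" by (rule p_exp_le[OF r]) (use d in auto)
    also have "p r d \<le> (1 + r) ^ K * p r (1 - d)"
      by (rule step[OF r]) (use d K \<eta>(1) in \<open>auto simp: field_simps\<close>)
    also have "p r (1 - d) \<le> exp (r * (1 - (1 - d))) * p r 1" by (rule p_exp_le[OF r]) (use d in auto)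
    also have "(1 + r) ^ K \<le> ((1 + 1 / s) * exp (s * r)) ^ K"
    proof (rule power_mono)
      have "1 + r \<le> (1 + 1 / s) * (1 + s * r)" using s r by (simp add: field_simps)
      also have "\<dots> \<le> (1 + 1 / s) * exp (s * r)" using s by (intro mult_left_mono) auto
      finally show "1 + r \<le> (1 + 1 / s) * exp (s * r)" .
    qed (use r in simp)
    also have "\<dots> = exp (K * ln (1 + 1 / s)) * exp (K * s * r)"
      using s by (simp add: power_mult_distrib exp_of_nat_mult add_pos_pos mult.assoc)
    finally have "p r 0 \<le> exp (r * (d - 0)) * (exp (K * ln (1 + 1 / s)) * exp (K * s * r)
        * (exp (r * (1 - (1 - d))) * p r 1))"
      using r p_1 by (simp add: mult_left_mono mult_right_mono)
    also have "\<dots> = exp (2 * d * r + K * s * r + K * ln (1 + 1 / s))"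
      by (simp add: p_1 exp_add[symmetric] algebra_simps)
    also have "\<dots> \<le> exp (\<delta> * r + K * ln (1 + 1 / s))"
    proof -
      have "(2 * d + K * s) * r \<le> \<delta> * r" using sK d(2) r by (intro mult_right_mono) auto
      then show ?thesis by (simp add: algebra_simps)
    qed
    finally show ?thesis .
  qed
  then show ?thesis using that by blast
qed

subsection \<open>Vanishing coefficients\<close>

lemma P_Suc_pos:
  assumes "0 \<le> y" "y < m" "m \<le> 1" "P n (\<phi> m) > 0"
  shows "P (Suc n) y > 0"
proof -
  have "0 < (m - y) * P n (\<phi> m)" using assms by simp
  also have "\<dots> = integral {y..m} (\<lambda>t. P n (\<phi> m))" using assms by simp
  also have "\<dots> \<le> integral {y..m} (\<lambda>t. P n (\<phi> t))"
  proof (rule integral_le)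
    show "(\<lambda>t. P n (\<phi> t)) integrable_on {y..m}" using assms by (intro integrable_P_phi) auto
    fix t assume "t \<in> {y..m}"
    then show "P n (\<phi> m) \<le> P n (\<phi> t)" using assms phi_mono[of t m] by (intro P_antimono) auto
  qed (rule integrable_const_ivl)
  also have "\<dots> \<le> P (Suc n) y"
    unfolding P.simps by (rule integral_subset_le) (use assms in \<open>auto intro: integrable_P_phi P_nonneg\<close>)
  finally show ?thesis .
qed

text \<open>Chains of any length fit near a fixed point at 0. Each longer chain starts so close to 0
  that, by continuity, \<open>\<phi>\<close> still maps its first element to at most the old
  starting point \<open>m\<close>.\<close>

lemma P_pos_of_fixed_0:
  assumes "\<phi> 0 = 0"
  shows "P n 0 > 0"
proof -
  have "\<exists>m. 0 < m \<and> m < 1 \<and> P n m > 0"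
  proof (induction n)
    case 0
    show ?case by (intro exI[of _ "1/2"]) simp
  next
    case (Suc n)
    then obtain m where m: "0 < m" "m < 1" "P n m > 0" by blast
    obtain d where d: "d > 0" "\<And>x. x \<in> {0..1} \<Longrightarrow> dist x 0 < d \<Longrightarrow> dist (\<phi> x) (\<phi> 0) < m"
      using cont m(1) unfolding continuous_on_iff by (metis atLeastAtMost_iff order.refl zero_le_one)
    define s where "s = min (d / 2) (1 / 2)"
    have s: "0 < s" "s < 1" "s < d" using d(1) by (auto simp: s_def)
    then have "\<phi> s \<le> m" using d(2)[of s] assms by (simp add: dist_real_def)
    then have "P n m \<le> P n (\<phi> s)" using s m by (intro P_antimono) auto
    then have "P (Suc n) (s / 2) > 0" using s m by (intro P_Suc_pos[of _ s]) auto
    then show ?case using s by (intro exI[of _ "s / 2"]) auto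
  qed
  then obtain m where "0 < m" "m < 1" "P n m > 0" by blast
  then show ?thesis using P_antimono[of 0 m n] by force
qed

lemma P_pos_of_less_1:
  assumes "\<And>x. 0 \<le> x \<Longrightarrow> x < 1 \<Longrightarrow> \<phi> x < 1" "0 \<le> y" "y < 1"
  shows "P n y > 0"
  using assms(2,3)
proof (induction n arbitrary: y)
  case (Suc n)
  then show ?case using assms(1)[of "(y + 1) / 2"] by (intro P_Suc_pos[of _ "(y + 1) / 2"]) auto
qed simp

text \<open>\<open>\<phi>\<close> advances by at least a fixed \<open>\<eta>\<close> until it
  reaches 1: on \<open>[0, 1 - \<epsilon>]\<close> by compactness, with \<open>\<phi> 0 > 0\<close>
  settling the left end, and beyond it because \<open>\<phi>\<close> is already 1. Long chains do
  not fit.\<close>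

lemma P_eventually_0:
  assumes "\<phi> 0 > 0" "\<epsilon> \<in> {0<..<1}" "\<phi> (1 - \<epsilon>) = 1"
  obtains N where "\<And>n. n > N \<Longrightarrow> P n 0 = 0"
proof -
  have gt: "x < \<phi> x" if "x \<in> {0..1-\<epsilon>}" for x
    using that assms(1,2) above by (cases "x = 0") auto
  obtain \<eta> where \<eta>: "\<eta> > 0" "\<And>x. x \<in> {0..1-\<epsilon>} \<Longrightarrow> x + \<eta> \<le> \<phi> x"
    using phi_gap[of 0 "1 - \<epsilon>"] assms(2) gt by auto
  have jump: "min 1 (x + \<eta>) \<le> \<phi> x" if "0 \<le> x" "x \<le> 1" for x
  proof (cases "x \<le> 1 - \<epsilon>")
    case False
    then have "\<phi> (1 - \<epsilon>) \<le> \<phi> x" using that assms(2) by (intro phi_mono) auto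
    then show ?thesis using assms(3) by simp
  qed (use \<eta>(2)[of x] that in auto)
  \<comment> \<open>The index starts at \<open>Suc n\<close> because \<open>P 0\<close> is
    constantly 1, while \<open>P 1\<close> vanishes at 1 and anchors the induction.\<close>
  have zero: "P (Suc n) y = 0" if "0 \<le> y" "y \<le> 1" "1 - n * \<eta> \<le> y" for n y
    using that
  proof (induction n arbitrary: y)
    case (Suc n)
    have "P (Suc n) (\<phi> t) = 0" if "t \<in> {y..1}" for t
    proof (intro Suc.IH)
      have "0 \<le> n * \<eta>" using \<eta>(1) by simp
      moreover have "1 - n * \<eta> - \<eta> \<le> t" using Suc.prems(3) that by (simp add: algebra_simps)
      moreover have "1 \<le> \<phi> t \<or> t + \<eta> \<le> \<phi> t"
        using jump[of t] that Suc.prems(1) by (auto simp: min_le_iff_disj)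
      ultimately show "1 - n * \<eta> \<le> \<phi> t" by linarith
    qed (use that Suc.prems in auto)
    then have "P (Suc (Suc n)) y = integral {y..1} (\<lambda>t. 0)"
      unfolding P.simps(2)[of "Suc n"] by (intro integral_cong)
    then show ?case by simp
  qed (simp add: P.simps(2))
  obtain K :: nat where K: "1 / \<eta> < K" using reals_Archimedean2 by blast
  have "P n 0 = 0" if "n > Suc K" for n
  proof -
    from that obtain k where k: "n = Suc k" "k \<ge> K" by (cases n) auto
    have "1 \<le> K * \<eta>" using K \<eta>(1) by (simp add: field_simps)
    also have "\<dots> \<le> k * \<eta>" using k \<eta>(1) by (intro mult_right_mono) auto
    finally show ?thesis unfolding k(1) by (intro zero) auto
  qed
  then show ?thesis using that by blast
qed

lemma P_eventually_0_iff:
  "(\<exists>N. \<forall>n>N. P n 0 = 0) \<longleftrightarrow> \<phi> 0 > 0 \<and> (\<exists>\<epsilon>\<in>{0<..<1}. \<phi> (1 - \<epsilon>) = 1)"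
proof
  assume "\<exists>N. \<forall>n>N. P n 0 = 0"
  then obtain n where n: "P n 0 = 0" by (metis lessI)
  have "\<phi> 0 > 0"
    using P_pos_of_fixed_0[of n] n phi_in(1)[OF order.refl zero_le_one]
    by (metis less_irrefl order_le_less)
  moreover have "\<exists>\<epsilon>\<in>{0<..<1}. \<phi> (1 - \<epsilon>) = 1"
  proof (rule ccontr)
    assume neg: "\<not> ?thesis"
    have "\<phi> x < 1" if x: "0 \<le> x" "x < 1" for x
    proof (rule ccontr)
      assume "\<not> \<phi> x < 1"
      \<comment> \<open>Raising \<open>x\<close> to at least 1/2 keeps
        \<open>\<epsilon> = 1 - max x (1/2)\<close> strictly below 1, also when
        \<open>x = 0\<close>.\<close>
      then have "\<phi> (max x (1/2)) = 1"
      proof (intro antisym)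
        show "\<phi> (max x (1/2)) \<le> 1" using x by simp
        show "1 \<le> \<phi> (max x (1/2))"
          using phi_mono[of x "max x (1/2)"] x \<open>\<not> \<phi> x < 1\<close> by simp
      qed
      moreover have "1 - max x (1/2) \<in> {0<..<1}" using x by auto
      ultimately show False using neg by (metis diff_diff_eq2 add_diff_cancel_left')
    qed
    then show False using P_pos_of_less_1[of 0 n] n by simp
  qed
  ultimately show "\<phi> 0 > 0 \<and> (\<exists>\<epsilon>\<in>{0<..<1}. \<phi> (1 - \<epsilon>) = 1)" ..
next
  assume "\<phi> 0 > 0 \<and> (\<exists>\<epsilon>\<in>{0<..<1}. \<phi> (1 - \<epsilon>) = 1)"
  then show "\<exists>N. \<forall>n>N. P n 0 = 0" using P_eventually_0 by metis
qed

section \<open>The determinant, its derivatives and its growth\<close>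

text \<open>\<open>taylor_coeff z j n\<close> is the \<open>j\<close>th Taylor coefficient of \<open>w \<mapsto> (-w)^n\<close> at \<open>z\<close>. Hence \<open>G z j (\<phi> x)\<close> is the one
  of \<open>w \<mapsto> e\<^sub>w x\<close>, and \<open>G z j 0\<close> the one of the determinant \<open>D\<close>.\<close>

definition taylor_coeff :: "complex \<Rightarrow> nat \<Rightarrow> nat \<Rightarrow> complex" where
  "taylor_coeff z j n = of_nat (n choose j) * (-1) ^ n * z ^ (n - j)"

definition G :: "complex \<Rightarrow> nat \<Rightarrow> real \<Rightarrow> complex" where
  "G z j = S (taylor_coeff z j)"

definition D :: "complex \<Rightarrow> complex" where
  "D z = G z 0 0"

lemma exp_bounded_taylor_coeff: "exp_bounded (taylor_coeff z j)"
  unfolding exp_bounded_def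
proof (intro exI conjI allI)
  show "norm (taylor_coeff z j n) \<le> 1 * (2 * (1 + cmod z)) ^ n" for n
  proof -
    have "real (n choose j) \<le> 2 ^ n"
      using binomial_le_pow2[of n j] by (metis of_nat_le_iff of_nat_numeral of_nat_power)
    moreover have "cmod z ^ (n - j) \<le> (1 + cmod z) ^ (n - j)" by (intro power_mono) auto
    moreover have "\<dots> \<le> (1 + cmod z) ^ n" by (intro power_increasing) auto
    ultimately have "real (n choose j) * cmod z ^ (n - j) \<le> 2 ^ n * (1 + cmod z) ^ n"
      by (intro mult_mono) auto
    then show ?thesis
      unfolding taylor_coeff_def power_mult_distrib mult_1 by (simp add: norm_mult norm_power)
  qed
qed auto

lemma taylor_coeff_0 [simp]: "taylor_coeff z j 0 = (if j = 0 then 1 else 0)"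
  by (simp add: taylor_coeff_def)

lemma taylor_coeff_Suc_0: "taylor_coeff z 0 (Suc n) = - z * taylor_coeff z 0 n"
  by (simp add: taylor_coeff_def)

text \<open>The product rule for \<open>(- w) ^ Suc n = - w * (- w) ^ n\<close>, here Pascal's rule.
  It carries the integral equation of e_z over to its Taylor coefficients.\<close>

lemma taylor_coeff_Suc_Suc: "taylor_coeff z (Suc j) (Suc n) = - z * taylor_coeff z (Suc j) n - taylor_coeff z j n"
proof (cases "Suc j \<le> n")
  case True
  then have "n - j = Suc (n - Suc j)" by simp
  then show ?thesis by (simp add: taylor_coeff_def algebra_simps)
qed (simp add: taylor_coeff_def algebra_simps)

lemma continuous_on_G: "continuous_on {0..1} (G z j)"
  unfolding G_def by (rule continuous_on_S[OF exp_bounded_taylor_coeff])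

lemma continuous_on_G_phi: "0 \<le> a \<Longrightarrow> b \<le> 1 \<Longrightarrow> continuous_on {a..b} (\<lambda>t. G z j (\<phi> t))"
  by (rule continuous_on_compose_phi[OF continuous_on_G])

lemma G_0_rec:
  assumes "0 \<le> y" "y \<le> 1"
  shows "G z 0 y = 1 - z * integral {y..1} (\<lambda>t. G z 0 (\<phi> t))"
proof -
  have "integral {y..1} (\<lambda>t. S (\<lambda>n. taylor_coeff z 0 (Suc n)) (\<phi> t)) = integral {y..1} (\<lambda>t. - z * G z 0 (\<phi> t))"
    unfolding taylor_coeff_Suc_0 G_def
    by (rule integral_cong, rule S_scale[OF exp_bounded_taylor_coeff]) (use assms in auto)
  then show ?thesis
    using S_rec[OF exp_bounded_taylor_coeff assms, of z 0] by (simp add: G_def)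
qed

lemma G_Suc_rec:
  assumes "0 \<le> y" "y \<le> 1"
  shows "G z (Suc j) y = - z * integral {y..1} (\<lambda>t. G z (Suc j) (\<phi> t)) - integral {y..1} (\<lambda>t. G z j (\<phi> t))"
proof -
  have eq: "S (\<lambda>n. taylor_coeff z (Suc j) (Suc n)) x = - z * G z (Suc j) x - G z j x" if "0 \<le> x" "x \<le> 1" for x
  proof -
    have "(\<lambda>n. - z * (P n x *\<^sub>R taylor_coeff z (Suc j) n) - P n x *\<^sub>R taylor_coeff z j n) sums (- z * G z (Suc j) x - G z j x)"
      unfolding G_def S_def
      by (intro sums_diff sums_mult summable_sums summable_S[OF exp_bounded_taylor_coeff that])
    then show ?thesis unfolding S_def taylor_coeff_Suc_Suc
      by (simp add: sums_iff scaleR_diff_right)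
  qed
  have "integral {y..1} (\<lambda>t. S (\<lambda>n. taylor_coeff z (Suc j) (Suc n)) (\<phi> t))
      = integral {y..1} (\<lambda>t. - z * G z (Suc j) (\<phi> t) - G z j (\<phi> t))"
    by (rule integral_cong, rule eq) (use assms in auto)
  also have "\<dots> = integral {y..1} (\<lambda>t. - z * G z (Suc j) (\<phi> t)) - integral {y..1} (\<lambda>t. G z j (\<phi> t))"
    by (intro Henstock_Kurzweil_Integration.integral_diff integrable_continuous_real
        continuous_on_mult continuous_on_const continuous_on_G_phi) (use assms in auto)
  finally show ?thesis
    using S_rec[OF exp_bounded_taylor_coeff assms, of z "Suc j"] by (simp add: G_def)
qed

text \<open>The terms below \<open>j\<close> vanish with their binomial coefficients. Starting at
  \<open>j\<close> removes the truncated exponent \<open>n - j\<close> and leaves a power series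
  that can be differentiated termwise.\<close>

lemma G_at_0_powser:
  "summable (\<lambda>n. (of_nat ((n + j) choose j) * (-1) ^ (n + j) * of_real (P (n + j) 0)) * z ^ n)"
  "G z j 0 = (\<Sum>n. (of_nat ((n + j) choose j) * (-1) ^ (n + j) * of_real (P (n + j) 0)) * z ^ n)"
proof -
  have s: "summable (\<lambda>n. P n 0 *\<^sub>R taylor_coeff z j n)" by (rule summable_S[OF exp_bounded_taylor_coeff]) auto
  have eq: "(\<lambda>n. P (n + j) 0 *\<^sub>R taylor_coeff z j (n + j))
      = (\<lambda>n. (of_nat ((n + j) choose j) * (-1) ^ (n + j) * of_real (P (n + j) 0)) * z ^ n)"
    by (rule ext) (simp add: taylor_coeff_def scaleR_conv_of_real)
  show "summable (\<lambda>n. (of_nat ((n + j) choose j) * (-1) ^ (n + j) * of_real (P (n + j) 0)) * z ^ n)"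
    using summable_ignore_initial_segment[OF s, of j] unfolding eq .
  have "(\<Sum>n<j. P n 0 *\<^sub>R taylor_coeff z j n) = 0" by (rule sum.neutral) (simp add: taylor_coeff_def)
  then show "G z j 0 = (\<Sum>n. (of_nat ((n + j) choose j) * (-1) ^ (n + j) * of_real (P (n + j) 0)) * z ^ n)"
    unfolding G_def S_def using suminf_split_initial_segment[OF s, of j] unfolding eq by simp
qed

lemma DERIV_G: "((\<lambda>z. G z j 0) has_field_derivative of_nat (Suc j) * G z (Suc j) 0) (at z)"
proof -
  define c where "c j n = of_nat ((n + j) choose j) * (-1) ^ (n + j) * complex_of_real (P (n + j) 0)" for j n
  have G_c: "G z j 0 = (\<Sum>n. c j n * z ^ n)" for z j
    unfolding c_def by (rule G_at_0_powser(2))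
  have "(n + Suc j choose j) * Suc n = Suc j * (n + Suc j choose Suc j)" for n
    using binomial_absorb_comp[of "n + Suc j" j] binomial_absorption[of j "n + Suc j"]
    by (simp add: mult.commute)
  then have "of_nat (Suc n) * of_nat (n + Suc j choose j) = (of_nat (Suc j) * of_nat (n + Suc j choose Suc j) :: complex)" for n
    by (metis mult.commute of_nat_mult)
  then have "diffs (c j) = (\<lambda>n. of_nat (Suc j) * c (Suc j) n)"
    unfolding diffs_def c_def by (intro ext) (simp add: mult.assoc[symmetric])
  moreover have "((\<lambda>z. \<Sum>n. c j n * z ^ n) has_field_derivative (\<Sum>n. diffs (c j) n * z ^ n)) (at z)"
    by (rule termdiffs_strong_converges_everywhere) (unfold c_def, rule G_at_0_powser(1))
  moreover have "summable (\<lambda>n. c (Suc j) n * z ^ n)" unfolding c_def by (rule G_at_0_powser(1))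
  ultimately show ?thesis
    unfolding G_c by (simp only: mult.assoc suminf_mult)
qed

lemma holomorphic_D: "D holomorphic_on UNIV"
  unfolding D_def[abs_def] holomorphic_on_def field_differentiable_def
  using has_field_derivative_at_within[OF DERIV_G] by blast

lemma higher_deriv_D: "(deriv ^^ j) D z = fact j * G z j 0"
proof (induction j arbitrary: z)
  case 0
  show ?case by (simp add: D_def)
next
  case (Suc j)
  then have "(deriv ^^ j) D = (\<lambda>z. fact j * G z j 0)" by auto
  then have "(deriv ^^ Suc j) D z = deriv (\<lambda>z. fact j * G z j 0) z" by simp
  also have "\<dots> = fact j * (of_nat (Suc j) * G z (Suc j) 0)"
    by (intro DERIV_imp_deriv DERIV_cmult DERIV_G)
  finally show ?case by (simp add: algebra_simps)
qed

lemma D_0: "D 0 = 1"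
  unfolding D_def using G_0_rec[of 0 0] by simp

text \<open>At \<open>z = 0\<close> the function e_z is constantly 1, so the derivative is minus the
  length of \<open>[0, 1]\<close>. This is the origin of the limit 1 in (2).\<close>

lemma deriv_D_0: "deriv D 0 = -1"
proof -
  have G_1: "G 0 0 y = 1" if "0 \<le> y" "y \<le> 1" for y using G_0_rec[OF that, of 0] by simp
  have "integral {0..1} (\<lambda>t. G 0 0 (\<phi> t)) = integral {0..1::real} (\<lambda>t. 1)"
    by (intro integral_cong G_1) auto
  then show ?thesis
    using higher_deriv_D[of 1 0] G_Suc_rec[of 0 0 0] by simp
qed

text \<open>Only the term of index \<open>n\<close> survives at 0. The vanishing of derivatives of
  \<open>D\<close> is thereby the vanishing of chain volumes, as (1) requires.\<close>

lemma higher_deriv_D_0: "(deriv ^^ n) D 0 = fact n * ((-1) ^ n * of_real (P n 0))"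
proof -
  have "P k 0 *\<^sub>R taylor_coeff 0 n k = 0" if "k \<notin> {n}" for k
    using that by (cases "k < n") (auto simp: taylor_coeff_def)
  then have "G 0 n 0 = (\<Sum>k\<in>{n}. P k 0 *\<^sub>R taylor_coeff 0 n k)"
    unfolding G_def S_def by (intro suminf_finite) auto
  then show ?thesis by (simp add: higher_deriv_D taylor_coeff_def scaleR_conv_of_real mult.commute)
qed

lemma D_growth:
  assumes "\<delta> > 0"
  shows "\<exists>C. \<forall>w. cmod (D w) \<le> exp (\<delta> * cmod w + C)"
proof -
  obtain C where C: "\<And>r. r \<ge> 0 \<Longrightarrow> p r 0 \<le> exp (\<delta> * r + C)" using p_growth[OF assms] by blast
  have "cmod (D w) \<le> p (cmod w) 0" for w
    unfolding D_def G_def p_def S_def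
    by (rule norm_suminf_le[OF _ summable_S[OF exp_bounded_power]])
      (auto simp: taylor_coeff_def norm_mult norm_power P_nonneg)
  then show ?thesis using C order.trans norm_ge_zero by meson
qed

end

section \<open>Eigenvalues and generalized eigenspaces\<close>

abbreviation ae_eq :: "(real \<Rightarrow> complex) \<Rightarrow> (real \<Rightarrow> complex) \<Rightarrow> bool" (infix "\<doteq>" 50) where
  "f \<doteq> g \<equiv> (AE x in lebesgue_on {0..1}. f x = g x)"

lemma ae_eqI: "(\<And>x. 0 \<le> x \<Longrightarrow> x \<le> 1 \<Longrightarrow> f x = g x) \<Longrightarrow> f \<doteq> g"
  by (rule AE_I2) auto

section \<open>Square-integrable functions on the unit interval\<close>

lemma L2_integrable_on:
  assumes "f \<in> L2_01"
  shows "integrable (lebesgue_on {0..1}) f"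
proof (rule Bochner_Integration.integrable_bound)
  show "integrable (lebesgue_on {0..1}) (\<lambda>x. 1 + (cmod (f x))\<^sup>2)"
    by (rule Bochner_Integration.integrable_add[OF continuous_imp_integrable_real])
      (use assms in \<open>auto simp: L2_01_def\<close>)
  show "f \<in> borel_measurable (lebesgue_on {0..1})" using assms by (simp add: L2_01_def)
  have "cmod (f x) \<le> 1 + (cmod (f x))\<^sup>2" for x
  proof -
    have "0 \<le> (cmod (f x) - 1 / 2)\<^sup>2" by simp
    then show ?thesis by (simp add: power2_eq_square algebra_simps)
  qed
  then show "AE x in lebesgue_on {0..1}. norm (f x) \<le> norm (1 + (cmod (f x))\<^sup>2)" by simp
qed

lemma L2_set_integrable:
  assumes "f \<in> L2_01" "0 \<le> a" "b \<le> 1"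
  shows "set_integrable lebesgue {a..b} f"
proof -
  have "set_integrable lebesgue {0..1} f"
    using L2_integrable_on[OF assms(1)] unfolding set_integrable_def
    by (simp add: integrable_restrict_space)
  then show ?thesis by (rule set_integrable_subset) (use assms in auto)
qed

lemma continuous_L2:
  assumes "continuous_on {0..1} f"
  shows "f \<in> L2_01"
  unfolding L2_01_def
  by (auto intro!: continuous_imp_measurable_on_sets_lebesgue continuous_imp_integrable_real
      continuous_intros assms)

lemma L2_add:
  assumes "f \<in> L2_01" "g \<in> L2_01"
  shows "(\<lambda>x. f x + g x) \<in> L2_01"
proof -
  have m: "f \<in> borel_measurable (lebesgue_on {0..1})" "g \<in> borel_measurable (lebesgue_on {0..1})"
    using assms by (auto simp: L2_01_def)
  have "integrable (lebesgue_on {0..1}) (\<lambda>x. (cmod (f x + g x))\<^sup>2)"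
  proof (rule Bochner_Integration.integrable_bound)
    show "integrable (lebesgue_on {0..1}) (\<lambda>x. 2 * (cmod (f x))\<^sup>2 + 2 * (cmod (g x))\<^sup>2)"
      using assms by (auto simp: L2_01_def)
    show "(\<lambda>x. (cmod (f x + g x))\<^sup>2) \<in> borel_measurable (lebesgue_on {0..1})"
      using m by measurable
    have "(cmod (a + b))\<^sup>2 \<le> 2 * (cmod a)\<^sup>2 + 2 * (cmod b)\<^sup>2" for a b :: complex
    proof -
      have "(cmod (a + b))\<^sup>2 \<le> (cmod a + cmod b)\<^sup>2" by (intro power_mono norm_triangle_ineq) auto
      also have "\<dots> \<le> 2 * (cmod a)\<^sup>2 + 2 * (cmod b)\<^sup>2"
        using zero_le_power2[of "cmod a - cmod b"] by (simp add: power2_eq_square algebra_simps)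
      finally show ?thesis .
    qed
    then show "AE x in lebesgue_on {0..1}. norm ((cmod (f x + g x))\<^sup>2) \<le> norm (2 * (cmod (f x))\<^sup>2 + 2 * (cmod (g x))\<^sup>2)"
      by simp
  qed
  then show ?thesis using m unfolding L2_01_def by simp
qed

lemma L2_scale: "f \<in> L2_01 \<Longrightarrow> (\<lambda>x. c * f x) \<in> L2_01"
  by (auto simp: L2_01_def norm_mult power_mult_distrib)

lemma L2_comb: "f \<in> L2_01 \<Longrightarrow> g \<in> L2_01 \<Longrightarrow> (\<lambda>x. a * f x + b * g x) \<in> L2_01"
  by (intro L2_add L2_scale)

section \<open>The operator, its eigenfunctions and the resolvent equation\<close>

context volterra_composition
begin

text \<open>Passage from the Lebesgue to the gauge integral, in which intervals are split and null
  sets ignored below.\<close>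

lemma V_op_eq:
  assumes "f \<in> L2_01" "0 \<le> x" "x \<le> 1"
  shows "V_op \<phi> f x = integral {0..\<phi> x} f"
  unfolding V_op_def
  by (rule set_lebesgue_integral_eq_integral(2)[OF L2_set_integrable]) (use assms in auto)

lemma L2_integrable_real: "f \<in> L2_01 \<Longrightarrow> 0 \<le> a \<Longrightarrow> b \<le> 1 \<Longrightarrow> f integrable_on {a..b}"
  by (rule set_lebesgue_integral_eq_integral(1)[OF L2_set_integrable])

lemma continuous_on_V_op:
  assumes "f \<in> L2_01"
  shows "continuous_on {0..1} (V_op \<phi> f)"
proof -
  have "continuous_on {0..1} (\<lambda>y. integral {0..y} f)"
    by (rule indefinite_integral_continuous_1) (rule L2_integrable_real[OF assms order.refl order.refl])
  then have "continuous_on {0..1} (\<lambda>x. integral {0..\<phi> x} f)" by (rule continuous_on_compose_phi) auto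
  then show ?thesis
    by (rule continuous_on_eq) (use V_op_eq[OF assms] in auto)
qed

lemma V_op_L2: "f \<in> L2_01 \<Longrightarrow> V_op \<phi> f \<in> L2_01"
  by (rule continuous_L2[OF continuous_on_V_op])

lemma integral_ae_cong:
  assumes "f \<doteq> g" "0 \<le> a" "b \<le> 1"
  shows "integral {a..b} f = integral {a..b} g"
proof -
  have "AE x in lebesgue. x \<in> {0..1} \<longrightarrow> f x = g x"
    using assms(1) by (simp add: AE_restrict_space_iff)
  then obtain N where N: "{x \<in> space lebesgue. \<not> (x \<in> {0..1} \<longrightarrow> f x = g x)} \<subseteq> N"
    "emeasure lebesgue N = 0" "N \<in> sets lebesgue"
    using AE_E by blast
  show ?thesis
  proof (rule integral_spike)
    show "negligible N" using N(2,3) by (simp add: negligible_iff_null_sets null_setsI)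
    show "g x = f x" if x: "x \<in> {a..b} - N" for x
    proof -
      have "x \<in> {0..1}" using x assms(2,3) by auto
      then show ?thesis using N(1) x by auto
    qed
  qed
qed

lemma V_op_cong:
  assumes "f \<in> L2_01" "g \<in> L2_01" "f \<doteq> g" "0 \<le> x" "x \<le> 1"
  shows "V_op \<phi> f x = V_op \<phi> g x"
  unfolding V_op_eq[OF assms(1,4,5)] V_op_eq[OF assms(2,4,5)]
  by (rule integral_ae_cong) (use assms in auto)

lemma V_op_comb:
  assumes "f \<in> L2_01" "g \<in> L2_01" "0 \<le> x" "x \<le> 1"
  shows "V_op \<phi> (\<lambda>x. a * f x + b * g x) x = a * V_op \<phi> f x + b * V_op \<phi> g x"
  unfolding V_op_eq[OF L2_comb[OF assms(1,2)] assms(3,4)] V_op_eq[OF assms(1,3,4)] V_op_eq[OF assms(2,3,4)]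
proof (rule integral_unique)
  have "f integrable_on {0..\<phi> x}" "g integrable_on {0..\<phi> x}"
    using assms by (auto intro!: L2_integrable_real)
  then show "((\<lambda>x. a * f x + b * g x) has_integral a * integral {0..\<phi> x} f + b * integral {0..\<phi> x} g) {0..\<phi> x}"
    by (intro has_integral_add has_integral_mult_right integrable_integral)
qed

lemma V_shift_L2: "f \<in> L2_01 \<Longrightarrow> V_shift \<phi> \<mu> f \<in> L2_01"
  unfolding V_shift_def using L2_comb[OF V_op_L2, of f f 1 "- \<mu>"] by simp

lemma V_shift_cong:
  assumes "f \<in> L2_01" "g \<in> L2_01" "f \<doteq> g"
  shows "V_shift \<phi> \<mu> f \<doteq> V_shift \<phi> \<mu> g"
proof -
  have "V_op \<phi> f \<doteq> V_op \<phi> g" by (rule ae_eqI) (rule V_op_cong[OF assms])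
  with assms(3) show ?thesis by eventually_elim (simp add: V_shift_def)
qed

lemma V_shift_comb:
  assumes "f \<in> L2_01" "g \<in> L2_01"
  shows "V_shift \<phi> \<mu> (\<lambda>x. a * f x + b * g x) \<doteq> (\<lambda>x. a * V_shift \<phi> \<mu> f x + b * V_shift \<phi> \<mu> g x)"
  by (rule ae_eqI) (simp add: V_shift_def V_op_comb[OF assms] algebra_simps)

text \<open>In the notation of the introduction, \<open>1 + z W\<close> is injective.\<close>

lemma volterra_unique:
  assumes u: "u \<in> L2_01" and eq: "u \<doteq> (\<lambda>x. z * (V_op \<phi> u x - integral {0..1} u))"
  shows "u \<doteq> (\<lambda>x. 0)"
proof -
  \<comment> \<open>\<open>w\<close> agrees with \<open>u\<close> almost everywhere but is
    continuous, hence bounded, and satisfies its equation at every point.\<close>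
  define w where "w x = z * (V_op \<phi> u x - integral {0..1} u)" for x
  have cw: "continuous_on {0..1} w"
    unfolding w_def by (intro continuous_intros continuous_on_V_op[OF u])
  then have w: "w \<in> L2_01" by (rule continuous_L2)
  have uw: "u \<doteq> w" using eq by (simp add: w_def[abs_def])
  have w_rec: "w x = - z * integral {\<phi> x..1} w" if x: "0 \<le> x" "x \<le> 1" for x
  proof -
    have "integral {0..\<phi> x} u + integral {\<phi> x..1} u = integral {0..1} u"
      by (rule Henstock_Kurzweil_Integration.integral_combine) (use x L2_integrable_real[OF u] in auto)
    moreover have "integral {\<phi> x..1} u = integral {\<phi> x..1} w"
      by (rule integral_ae_cong[OF uw]) (use x in auto)
    ultimately show ?thesis unfolding w_def V_op_eq[OF u x]
      by (metis (no_types, lifting) add_diff_cancel_left' minus_diff_eq mult_minus_left mult_minus_right w_def)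
  qed
  obtain M where "\<forall>x\<in>{0..1}. cmod (w x) \<le> M"
    using compact_imp_bounded[OF compact_continuous_image[OF cw compact_Icc]]
    unfolding bounded_iff by auto
  then have M: "\<And>x. x \<in> {0..1} \<Longrightarrow> cmod (w x) \<le> M" by blast
  \<comment> \<open>Iterating \<open>w_rec\<close> with \<open>\<phi> x \<ge> x\<close> produces
    simplex volumes, whose factorials defeat \<open>cmod z ^ n\<close>.\<close>
  have bound: "cmod (w x) \<le> M * cmod z ^ n * ((1 - x) ^ n / fact n)" if "0 \<le> x" "x \<le> 1" for n x
    using that
  proof (induction n arbitrary: x)
    case 0
    then show ?case using M by simp
  next
    case (Suc n)
    have phi: "0 \<le> \<phi> x" "x \<le> \<phi> x" "\<phi> x \<le> 1" using Suc.prems phi_ge by auto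
    have I: "((\<lambda>t. M * cmod z ^ n * ((1 - t) ^ n / fact n)) has_integral
        M * cmod z ^ n * ((1 - \<phi> x) ^ Suc n / fact (Suc n))) {\<phi> x..1}"
      by (intro has_integral_mult_right integral_power_tail phi)
    have "0 \<le> M" using order.trans[OF norm_ge_zero M[of 0]] by simp
    have "cmod (integral {\<phi> x..1} w) \<le> integral {\<phi> x..1} (\<lambda>t. M * cmod z ^ n * ((1 - t) ^ n / fact n))"
    proof (rule integral_norm_bound_integral)
      show "cmod (w t) \<le> M * cmod z ^ n * ((1 - t) ^ n / fact n)" if "t \<in> {\<phi> x..1}" for t
        by (rule Suc.IH) (use that phi in auto)
    qed (use I L2_integrable_real[OF w] phi in auto)
    also have "\<dots> = M * cmod z ^ n * ((1 - \<phi> x) ^ Suc n / fact (Suc n))"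
      using I by (rule integral_unique)
    also have "\<dots> \<le> M * cmod z ^ n * ((1 - x) ^ Suc n / fact (Suc n))"
      using phi \<open>0 \<le> M\<close> by (intro mult_left_mono divide_right_mono power_mono) auto
    finally have "cmod z * cmod (integral {\<phi> x..1} w) \<le> cmod z * (M * cmod z ^ n * ((1 - x) ^ Suc n / fact (Suc n)))"
      by (rule mult_left_mono) simp
    then show ?case using w_rec[OF Suc.prems] by (simp add: norm_mult mult_ac)
  qed
  have "w x = 0" if x: "0 \<le> x" "x \<le> 1" for x
  proof -
    have "(\<lambda>n. M * (inverse (fact n) * (cmod z * (1 - x)) ^ n)) \<longlonglongrightarrow> M * 0"
      by (intro tendsto_mult tendsto_const summable_LIMSEQ_zero summable_exp)
    then have "cmod (w x) \<le> M * 0"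
      by (rule tendsto_lowerbound)
        (use bound[OF x] in \<open>auto intro!: always_eventually simp: power_mult_distrib divide_inverse mult_ac\<close>)
    then show ?thesis by simp
  qed
  then have "w \<doteq> (\<lambda>x. 0)" by (intro ae_eqI) auto
  with uw show ?thesis by eventually_elim simp
qed

definition g :: "complex \<Rightarrow> nat \<Rightarrow> real \<Rightarrow> complex" where
  "g z j x = G z j (\<phi> x)"

lemma continuous_on_g: "continuous_on {0..1} (g z j)"
  unfolding g_def[abs_def] by (rule continuous_on_G_phi) auto

lemma g_L2: "g z j \<in> L2_01"
  by (rule continuous_L2[OF continuous_on_g])

lemma integral_g_split:
  assumes "0 \<le> x" "x \<le> 1"
  shows "integral {0..1} (g z j) = V_op \<phi> (g z j) x + integral {\<phi> x..1} (g z j)"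
  unfolding V_op_eq[OF g_L2 assms]
  by (rule Henstock_Kurzweil_Integration.integral_combine[symmetric])
    (use assms L2_integrable_real[OF g_L2] in auto)

text \<open>Splitting \<open>[0, 1]\<close> at \<open>\<phi> x\<close> turns the tail integral of
  the recursion into \<open>V_op\<close>, and the total integral is absorbed in
  \<open>D z\<close>.\<close>

lemma g_0_eq:
  assumes "0 \<le> x" "x \<le> 1"
  shows "g z 0 x = z * V_op \<phi> (g z 0) x + D z"
proof -
  have g: "g z 0 x = 1 - z * integral {\<phi> x..1} (g z 0)"
    using G_0_rec[of "\<phi> x" z] assms by (simp add: g_def[abs_def])
  have D: "D z = 1 - z * integral {0..1} (g z 0)"
    using G_0_rec[of 0 z] by (simp add: g_def[abs_def] D_def)
  show ?thesis unfolding g D integral_g_split[OF assms] by (simp add: algebra_simps)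
qed

text \<open>The next Taylor coefficients of the preceding identity; the middle term stems from
  differentiating the factor \<open>z\<close>.\<close>

lemma g_Suc_eq:
  assumes "0 \<le> x" "x \<le> 1"
  shows "g z (Suc j) x = z * V_op \<phi> (g z (Suc j)) x + V_op \<phi> (g z j) x + G z (Suc j) 0"
proof -
  have g: "g z (Suc j) x = - z * integral {\<phi> x..1} (g z (Suc j)) - integral {\<phi> x..1} (g z j)"
    using G_Suc_rec[of "\<phi> x" z j] assms by (simp add: g_def[abs_def])
  have G: "G z (Suc j) 0 = - z * integral {0..1} (g z (Suc j)) - integral {0..1} (g z j)"
    using G_Suc_rec[of 0 z j] by (simp add: g_def[abs_def])
  show ?thesis unfolding g G integral_g_split[OF assms] by (simp add: algebra_simps)
qed

text \<open>With \<open>z = 1/\<mu>\<close> and \<open>e\<^sub>z = g z 0\<close>, the equation \<open>V h - \<mu> h = k\<close> reads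
  \<open>(1 + z W) h = \<beta>\<close> for the constant \<open>\<beta> = z (\<integral> h - k)\<close>, so \<open>h = \<beta> e\<^sub>z\<close>; integrating gives the
  consistency condition on \<open>\<beta>\<close>.\<close>

lemma resolvent_const:
  assumes h: "h \<in> L2_01" and \<mu>: "\<mu> \<noteq> 0" and eq: "V_shift \<phi> \<mu> h \<doteq> (\<lambda>x. k)"
  obtains \<beta> where "h \<doteq> (\<lambda>x. \<beta> * g (1 / \<mu>) 0 x)" "\<beta> * D (1 / \<mu>) = - k / \<mu>"
proof -
  define z where "z = 1 / \<mu>"
  define c where "c = integral {0..1} h"
  define \<beta> where "\<beta> = z * (c - k)"
  define u where "u x = 1 * h x + (- \<beta>) * g z 0 x" for x
  have u: "u \<in> L2_01" unfolding u_def[abs_def] by (rule L2_comb[OF h g_L2])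
  have D1: "D z = 1 - z * integral {0..1} (g z 0)"
    using G_0_rec[of 0 z] by (simp add: g_def[abs_def] D_def)
  \<comment> \<open>Because \<open>\<phi> 1 = 1\<close>, the value of \<open>V_op\<close> at 1 is
    the integral over the whole interval.\<close>
  have int_u: "integral {0..1} u = c - \<beta> * integral {0..1} (g z 0)"
    using V_op_comb[OF h g_L2, of 1 1 "- \<beta>" z 0] V_op_eq[OF u, of 1] V_op_eq[OF h, of 1]
      V_op_eq[OF g_L2, of 1 z 0] phi_1 by (simp add: u_def[abs_def] c_def)
  have "u \<doteq> (\<lambda>x. z * (V_op \<phi> u x - integral {0..1} u))"
  proof -
    have "V_op \<phi> u \<doteq> (\<lambda>x. V_op \<phi> h x - \<beta> * V_op \<phi> (g z 0) x)"
      by (rule ae_eqI) (use V_op_comb[OF h g_L2, of _ 1 "- \<beta>" z 0] in \<open>simp add: u_def[abs_def]\<close>)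
    moreover have "g z 0 \<doteq> (\<lambda>x. z * V_op \<phi> (g z 0) x + D z)"
      by (rule ae_eqI) (rule g_0_eq)
    ultimately show ?thesis using eq
    proof eventually_elim
      case (elim x)
      have hx: "h x = z * V_op \<phi> h x - z * k" using elim(3) \<mu> by (simp add: V_shift_def z_def field_simps)
      have zc: "c * z = \<beta> + k * z" by (simp add: \<beta>_def algebra_simps)
      show ?case
        unfolding elim(1) int_u u_def
        by (subst hx, subst elim(2), subst D1) (simp add: algebra_simps zc)
    qed
  qed
  then have "u \<doteq> (\<lambda>x. 0)" by (rule volterra_unique[OF u])
  then have h\<beta>: "h \<doteq> (\<lambda>x. \<beta> * g z 0 x)" by eventually_elim (simp add: u_def)
  have "c = \<beta> * integral {0..1} (g z 0)"
    unfolding c_def using integral_ae_cong[OF h\<beta>, of 0 1] by simp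
  then have "\<beta> * D z = - k / \<mu>"
    unfolding D1 using \<mu> by (simp add: \<beta>_def z_def field_simps)
  then show ?thesis using that h\<beta> unfolding z_def by blast
qed

text \<open>If e_z were null, its integral would vanish, giving \<open>D z = 1\<close>, and then
  \<open>g_0_eq\<close> would make e_z constantly 1.\<close>

lemma g_0_nonzero: "\<not> g z 0 \<doteq> (\<lambda>x. 0)"
proof
  assume 0: "g z 0 \<doteq> (\<lambda>x. 0)"
  have "integral {0..1} (g z 0) = 0" using integral_ae_cong[OF 0, of 0 1] by simp
  moreover have "D z = 1 - z * integral {0..1} (g z 0)"
    using G_0_rec[of 0 z] by (simp add: g_def[abs_def] D_def)
  ultimately have "D z = 1" by simp
  have V0: "V_op \<phi> (g z 0) x = 0" if "0 \<le> x" "x \<le> 1" for x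
    using integral_ae_cong[OF 0, of 0 "\<phi> x"] V_op_eq[OF g_L2 that, of z 0] that by simp
  then have "g z 0 \<doteq> (\<lambda>x. 1)"
    by (intro ae_eqI) (simp add: g_0_eq \<open>D z = 1\<close>)
  with 0 have "AE x in lebesgue_on {0..1::real}. False" by eventually_elim simp
  then obtain N where N: "{x \<in> space (lebesgue_on {0..1::real}). \<not> False} \<subseteq> N"
    "emeasure (lebesgue_on {0..1}) N = 0" "N \<in> sets (lebesgue_on {0..1})"
    by (rule AE_E)
  from N(1) have "{0..1} \<subseteq> N" by auto
  then have "emeasure (lebesgue_on {0..1::real}) {0..1} \<le> 0"
    using N emeasure_mono[of "{0..1}" N "lebesgue_on {0..1}"] by simp
  then show False by (simp add: emeasure_restrict_space)
qed

lemma eigenvalue_iff: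
  assumes "\<mu> \<noteq> 0"
  shows "eigenvalue \<phi> \<mu> \<longleftrightarrow> D (1 / \<mu>) = 0"
proof
  assume "eigenvalue \<phi> \<mu>"
  then obtain f where f: "f \<in> L2_01" "\<not> f \<doteq> (\<lambda>x. 0)" "V_shift \<phi> \<mu> f \<doteq> (\<lambda>x. 0)"
    by (auto simp: eigenvalue_def ae_zero_def)
  obtain \<beta> where \<beta>: "f \<doteq> (\<lambda>x. \<beta> * g (1 / \<mu>) 0 x)" "\<beta> * D (1 / \<mu>) = - 0 / \<mu>"
    using resolvent_const[OF f(1) assms f(3)] by blast
  have "\<beta> \<noteq> 0" using \<beta>(1) f(2) by auto
  then show "D (1 / \<mu>) = 0" using \<beta>(2) by simp
next
  assume D: "D (1 / \<mu>) = 0"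
  have "V_shift \<phi> \<mu> (g (1 / \<mu>) 0) \<doteq> (\<lambda>x. 0)"
    by (rule ae_eqI) (use g_0_eq[of _ "1 / \<mu>"] assms in \<open>simp add: V_shift_def D field_simps\<close>)
  then show "eigenvalue \<phi> \<mu>"
    unfolding eigenvalue_def ae_zero_def using g_L2 g_0_nonzero by blast
qed

end

section \<open>Algebraic multiplicity equals the order of the zero\<close>

text \<open>Elimination with a pivot \<open>f0\<close>. Independence is meant modulo null sets, so
  dimensions are compared through coefficient systems instead of in a quotient space.\<close>

lemma nontrivial_solution:
  fixes a :: "'b \<Rightarrow> nat \<Rightarrow> complex"
  assumes "finite F" "card F > m"
  shows "\<exists>c. (\<exists>f\<in>F. c f \<noteq> 0) \<and> (\<forall>i<m. (\<Sum>f\<in>F. c f * a f i) = 0)"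
  using assms
proof (induction m arbitrary: F a)
  case 0
  then have "F \<noteq> {}" by auto
  then show ?case by (intro exI[of _ "\<lambda>_. 1"]) auto
next
  case (Suc m)
  show ?case
  proof (cases "\<forall>f\<in>F. a f m = 0")
    case True
    obtain c where "\<exists>f\<in>F. c f \<noteq> 0" "\<forall>i<m. (\<Sum>f\<in>F. c f * a f i) = 0"
      using Suc.IH[of F a] Suc.prems by auto
    then show ?thesis using True by (intro exI[of _ c]) (auto simp: less_Suc_eq)
  next
    case False
    then obtain f0 where f0: "f0 \<in> F" "a f0 m \<noteq> 0" by blast
    define r where "r f = a f m / a f0 m" for f
    have "m < card (F - {f0})" using Suc.prems f0(1) by simp
    then obtain c where c: "\<exists>f\<in>F - {f0}. c f \<noteq> 0"
      "\<And>i. i < m \<Longrightarrow> (\<Sum>f\<in>F - {f0}. c f * (a f i - r f * a f0 i)) = 0"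
      using Suc.IH[of "F - {f0}" "\<lambda>f i. a f i - r f * a f0 i"] Suc.prems(1) by auto
    \<comment> \<open>The pivot's coefficient is chosen so that the equation of index
      \<open>m\<close> holds.\<close>
    define c' where "c' = c(f0 := - (\<Sum>f\<in>F - {f0}. c f * r f))"
    have eq: "(\<Sum>f\<in>F. c' f * a f i) = (\<Sum>f\<in>F - {f0}. c f * (a f i - r f * a f0 i))" for i
    proof -
      have "(\<Sum>f\<in>F. c' f * a f i) = c' f0 * a f0 i + (\<Sum>f\<in>F - {f0}. c' f * a f i)"
        using Suc.prems(1) f0(1) by (rule sum.remove)
      also have "(\<Sum>f\<in>F - {f0}. c' f * a f i) = (\<Sum>f\<in>F - {f0}. c f * a f i)"
        by (rule sum.cong) (auto simp: c'_def)
      also have "c' f0 * a f0 i = - (\<Sum>f\<in>F - {f0}. c f * r f * a f0 i)"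
        by (simp add: c'_def sum_distrib_right)
      finally show ?thesis by (simp add: sum_subtractf right_diff_distrib mult.assoc)
    qed
    have "(\<Sum>f\<in>F. c' f * a f i) = 0" if "i < Suc m" for i
    proof (cases "i = m")
      case True
      then show ?thesis unfolding eq using f0(2) by (simp add: r_def)
    qed (use that c(2) eq in auto)
    moreover have "\<exists>f\<in>F. c' f \<noteq> 0" using c(1) by (auto simp: c'_def)
    ultimately show ?thesis by blast
  qed
qed

text \<open>\<open>G (1 / \<mu>) j 0\<close> is the \<open>j\<close>th Taylor coefficient of
  \<open>D\<close> at \<open>1 / \<mu>\<close>, so \<open>m\<close> is the order of the zero, in the
  form in which the operator identities produce it.\<close>

locale volterra_eigenvalue = volterra_composition +
  fixes \<mu> :: complex and m :: nat
  assumes \<mu>: "\<mu> \<noteq> 0" and m_pos: "m > 0"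
    and zero: "\<And>j. j < m \<Longrightarrow> G (1 / \<mu>) j 0 = 0" and nonzero: "G (1 / \<mu>) m 0 \<noteq> 0"
begin

abbreviation A :: "(real \<Rightarrow> complex) \<Rightarrow> real \<Rightarrow> complex" where "A \<equiv> V_shift \<phi> \<mu>"
abbreviation e :: "nat \<Rightarrow> real \<Rightarrow> complex" where "e \<equiv> g (1 / \<mu>)"

definition chain_span :: "nat \<Rightarrow> (real \<Rightarrow> complex) set" where
  "chain_span n = {f \<in> L2_01. \<exists>c. f \<doteq> (\<lambda>x. \<Sum>i<n. c i * e i x)}"

lemma D_zero: "D (1 / \<mu>) = 0"
  using zero[OF m_pos] by (simp add: D_def)

lemma A_e_0: "A (e 0) \<doteq> (\<lambda>x. 0)"
  by (rule ae_eqI) (use g_0_eq[of _ "1 / \<mu>"] \<mu> in \<open>simp add: V_shift_def D_zero field_simps\<close>)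

text \<open>Not quite a Jordan relation: besides \<open>e j\<close> there is \<open>A (e j)\<close>,
  which for \<open>j < m\<close> lies lower in the chain. The constant is the next Taylor
  coefficient of \<open>D\<close> and vanishes while \<open>Suc j < m\<close>.\<close>

lemma A_e_Suc: "A (e (Suc j)) \<doteq> (\<lambda>x. - \<mu>\<^sup>2 * e j x - \<mu> * A (e j) x - \<mu> * G (1 / \<mu>) (Suc j) 0)"
proof (rule ae_eqI)
  fix x :: real assume x: "0 \<le> x" "x \<le> 1"
  have "\<mu> * e (Suc j) x = V_op \<phi> (e (Suc j)) x + \<mu> * V_op \<phi> (e j) x + \<mu> * G (1 / \<mu>) (Suc j) 0"
    by (subst g_Suc_eq[OF x]) (use \<mu> in \<open>simp add: algebra_simps\<close>)
  then show "A (e (Suc j)) x = - \<mu>\<^sup>2 * e j x - \<mu> * A (e j) x - \<mu> * G (1 / \<mu>) (Suc j) 0"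
    by (simp add: V_shift_def power2_eq_square algebra_simps)
qed

lemma chain_spanI:
  "f \<in> L2_01 \<Longrightarrow> f \<doteq> (\<lambda>x. \<Sum>i<n. c i * e i x) \<Longrightarrow> f \<in> chain_span n"
  by (auto simp: chain_span_def)

lemma chain_span_L2: "f \<in> chain_span n \<Longrightarrow> f \<in> L2_01"
  by (simp add: chain_span_def)

lemma chain_span_cong: "f \<in> chain_span n \<Longrightarrow> h \<in> L2_01 \<Longrightarrow> h \<doteq> f \<Longrightarrow> h \<in> chain_span n"
proof -
  assume "f \<in> chain_span n" and h: "h \<in> L2_01" "h \<doteq> f"
  then obtain c where "f \<doteq> (\<lambda>x. \<Sum>i<n. c i * e i x)" by (auto simp: chain_span_def)
  with h(2) have "h \<doteq> (\<lambda>x. \<Sum>i<n. c i * e i x)" by eventually_elim simp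
  then show ?thesis using h(1) by (auto simp: chain_span_def)
qed

lemma chain_span_comb:
  assumes "f \<in> chain_span n" "h \<in> chain_span n"
  shows "(\<lambda>x. a * f x + b * h x) \<in> chain_span n"
proof -
  obtain c d where "f \<doteq> (\<lambda>x. \<Sum>i<n. c i * e i x)" "h \<doteq> (\<lambda>x. \<Sum>i<n. d i * e i x)"
    using assms by (auto simp: chain_span_def)
  then have "(\<lambda>x. a * f x + b * h x) \<doteq> (\<lambda>x. \<Sum>i<n. (a * c i + b * d i) * e i x)"
    by eventually_elim (simp add: sum_distrib_left sum.distrib algebra_simps)
  then show ?thesis
    using L2_comb[OF chain_span_L2[OF assms(1)] chain_span_L2[OF assms(2)]]
    by (auto simp: chain_span_def intro!: exI[of _ "\<lambda>i. a * c i + b * d i"])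
qed

lemma sum_e_L2: "(\<lambda>x. \<Sum>i<n. c i * e i x) \<in> L2_01"
  by (rule continuous_L2) (intro continuous_intros continuous_on_g)

lemma chain_span_0_iff: "f \<in> chain_span 0 \<longleftrightarrow> f \<in> L2_01 \<and> f \<doteq> (\<lambda>x. 0)"
  by (auto simp: chain_span_def)

lemma chain_span_SucE:
  assumes "f \<in> chain_span (Suc n)"
  obtains c h where "h \<in> chain_span n" "f \<doteq> (\<lambda>x. 1 * h x + c * e n x)"
proof -
  obtain c where c: "f \<doteq> (\<lambda>x. \<Sum>i<Suc n. c i * e i x)" using assms by (auto simp: chain_span_def)
  have "(\<lambda>x. \<Sum>i<n. c i * e i x) \<in> chain_span n"
    using sum_e_L2 by (auto simp: chain_span_def)
  then show ?thesis by (rule that[of _ "c n"]) (use c in simp)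
qed

lemma chain_span_Suc: "f \<in> chain_span n \<Longrightarrow> f \<in> chain_span (Suc n)"
proof -
  assume f: "f \<in> chain_span n"
  then obtain c where c: "f \<doteq> (\<lambda>x. \<Sum>i<n. c i * e i x)" by (auto simp: chain_span_def)
  have "(\<Sum>i<Suc n. (if i < n then c i else 0) * e i x) = (\<Sum>i<n. c i * e i x)" for x by simp
  then have "f \<doteq> (\<lambda>x. \<Sum>i<Suc n. (if i < n then c i else 0) * e i x)" using c by (simp only:)
  then show ?thesis by (rule chain_spanI[OF chain_span_L2[OF f]])
qed

lemma e_in_chain_span: "e n \<in> chain_span (Suc n)"
proof -
  have "(\<Sum>i<Suc n. (if i < n then 0 else 1) * e i x) = e n x" for x by simp
  then have "e n \<doteq> (\<lambda>x. \<Sum>i<Suc n. (if i < n then 0 else 1) * e i x)" by (simp only:) simp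
  then show ?thesis by (rule chain_spanI[OF g_L2])
qed

lemma A_e_Suc_less:
  "Suc j < m \<Longrightarrow> A (e (Suc j)) \<doteq> (\<lambda>x. (- \<mu>\<^sup>2) * e j x + (- \<mu>) * A (e j) x)"
  using A_e_Suc[of j] by (simp add: zero)

lemma A_e_in: "j < m \<Longrightarrow> A (e j) \<in> chain_span j"
proof (induction j)
  case 0
  then show ?case using A_e_0 V_shift_L2[OF g_L2] by (simp add: chain_span_0_iff)
next
  case (Suc j)
  then have "(\<lambda>x. (- \<mu>\<^sup>2) * e j x + (- \<mu>) * A (e j) x) \<in> chain_span (Suc j)"
    by (intro chain_span_comb e_in_chain_span chain_span_Suc) auto
  then show ?case
    by (rule chain_span_cong[OF _ V_shift_L2[OF g_L2] A_e_Suc_less[OF Suc.prems]])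
qed

lemma A_chain_span_comb:
  assumes "h \<in> L2_01" "f \<in> L2_01" "f \<doteq> (\<lambda>x. a * h x + c * e n x)"
  shows "A f \<doteq> (\<lambda>x. a * A h x + c * A (e n) x)"
proof -
  have "A f \<doteq> A (\<lambda>x. a * h x + c * e n x)"
    by (rule V_shift_cong[OF assms(2) L2_comb[OF assms(1) g_L2] assms(3)])
  moreover have "A (\<lambda>x. a * h x + c * e n x) \<doteq> (\<lambda>x. a * A h x + c * A (e n) x)"
    by (rule V_shift_comb[OF assms(1) g_L2])
  ultimately show ?thesis by eventually_elim simp
qed

lemma A_chain_span: "f \<in> chain_span (Suc n) \<Longrightarrow> n < m \<Longrightarrow> A f \<in> chain_span n"
proof (induction n arbitrary: f)
  case 0
  obtain c h where h: "h \<in> chain_span 0" "f \<doteq> (\<lambda>x. 1 * h x + c * e 0 x)"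
    using chain_span_SucE[OF 0(1)] by blast
  from h(1) have "h \<doteq> (\<lambda>x. 0)" by (simp add: chain_span_0_iff)
  with h(2) have "f \<doteq> (\<lambda>x. 0 * e 0 x + c * e 0 x)" by eventually_elim simp
  then have "A f \<doteq> (\<lambda>x. 0 * A (e 0) x + c * A (e 0) x)"
    by (rule A_chain_span_comb[OF g_L2 chain_span_L2[OF 0(1)]])
  with A_e_0 have "A f \<doteq> (\<lambda>x. 0)" by eventually_elim simp
  then show ?case using V_shift_L2[OF chain_span_L2[OF 0(1)]] by (simp add: chain_span_0_iff)
next
  case (Suc n)
  obtain c h where h: "h \<in> chain_span (Suc n)" "f \<doteq> (\<lambda>x. 1 * h x + c * e (Suc n) x)"
    using chain_span_SucE[OF Suc.prems(1)] by blast
  have f: "f \<in> L2_01" by (rule chain_span_L2[OF Suc.prems(1)])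
  have "(\<lambda>x. 1 * A h x + c * A (e (Suc n)) x) \<in> chain_span (Suc n)"
    using Suc.IH[OF h(1)] Suc.prems(2) by (intro chain_span_comb chain_span_Suc A_e_in) auto
  then show ?case
    by (rule chain_span_cong[OF _ V_shift_L2[OF f] A_chain_span_comb[OF chain_span_L2[OF h(1)] f h(2)]])
qed

lemma A_pow_chain_span: "f \<in> chain_span n \<Longrightarrow> n \<le> m \<Longrightarrow> (A ^^ n) f \<doteq> (\<lambda>x. 0)"
proof (induction n arbitrary: f)
  case (Suc n)
  then have "(A ^^ n) (A f) \<doteq> (\<lambda>x. 0)" by (intro Suc.IH A_chain_span) auto
  then show ?case by (simp add: funpow_swap1)
qed (simp add: chain_span_0_iff)

lemma chain_span_subset: "chain_span m \<subseteq> gen_eigenspace \<phi> \<mu>"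
  using A_pow_chain_span chain_span_L2 unfolding gen_eigenspace_def ae_zero_def by blast

text \<open>Applying \<open>A\<close> lowers a relation by one level and multiplies its leading
  coefficient by \<open>- \<mu>\<^sup>2 \<noteq> 0\<close>; at the bottom \<open>e 0\<close> is not
  null.\<close>

lemma e_indep_step: "n < m \<Longrightarrow> h \<in> chain_span n \<Longrightarrow> (\<lambda>x. h x + c * e n x) \<doteq> (\<lambda>x. 0) \<Longrightarrow> c = 0"
proof (induction n arbitrary: c h)
  case 0
  from 0(2) have "h \<doteq> (\<lambda>x. 0)" by (simp add: chain_span_0_iff)
  with 0(3) have *: "(\<lambda>x. c * e 0 x) \<doteq> (\<lambda>x. 0)" by eventually_elim simp
  show ?case
  proof (rule ccontr)
    assume "c \<noteq> 0"
    with * have "e 0 \<doteq> (\<lambda>x. 0)" by simp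
    then show False using g_0_nonzero by blast
  qed
next
  case (Suc n)
  have h: "h \<in> L2_01" by (rule chain_span_L2[OF Suc.prems(2)])
  have 0: "(\<lambda>x. 0) \<in> L2_01" by (rule continuous_L2) simp
  have "(\<lambda>x. 0) \<doteq> (\<lambda>x. 1 * h x + c * e (Suc n) x)" using Suc.prems(3) by eventually_elim simp
  then have "A (\<lambda>x. 0) \<doteq> (\<lambda>x. 1 * A h x + c * A (e (Suc n)) x)"
    by (rule A_chain_span_comb[OF h 0])
  moreover have "A (\<lambda>x. 0) \<doteq> (\<lambda>x. 0)"
    by (rule ae_eqI) (simp add: V_shift_def V_op_def set_lebesgue_integral_def)
  ultimately have "(\<lambda>x. (1 * A h x + (- c * \<mu>) * A (e n) x) + (- c * \<mu>\<^sup>2) * e n x) \<doteq> (\<lambda>x. 0)"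
    using A_e_Suc_less[OF Suc.prems(1)] by eventually_elim (simp add: algebra_simps)
  moreover have "(\<lambda>x. 1 * A h x + (- c * \<mu>) * A (e n) x) \<in> chain_span n"
    using Suc.prems by (intro chain_span_comb A_chain_span A_e_in) auto
  ultimately have "- c * \<mu>\<^sup>2 = 0" by (intro Suc.IH Suc_lessD[OF Suc.prems(1)])
  then show ?case using \<mu> by simp
qed

lemma e_indep:
  assumes "(\<lambda>x. \<Sum>i<n. c i * e i x) \<doteq> (\<lambda>x. 0)" "n \<le> m" "i < n"
  shows "c i = 0"
  using assms
proof (induction n)
  case (Suc n)
  have "(\<lambda>x. \<Sum>i<n. c i * e i x) \<in> chain_span n" using sum_e_L2 by (auto simp: chain_span_def)
  moreover have "(\<lambda>x. (\<Sum>i<n. c i * e i x) + c n * e n x) \<doteq> (\<lambda>x. 0)" using Suc.prems(1) by simp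
  ultimately have cn: "c n = 0" by (rule e_indep_step[rotated]) (use Suc.prems(2) in simp)
  then have "(\<lambda>x. \<Sum>i<n. c i * e i x) \<doteq> (\<lambda>x. 0)" using Suc.prems(1) by simp
  then show ?case using Suc.IH Suc.prems cn by (cases "i = n") auto
qed simp

text \<open>By \<open>A_e_Suc\<close>, \<open>A (v j) = e j\<close> as long as the next Taylor coefficient of \<open>D\<close> vanishes, which
  fails precisely at the top of the Jordan chain.\<close>

definition v :: "nat \<Rightarrow> real \<Rightarrow> complex" where
  "v j x = (- 1 / \<mu>\<^sup>2) * e (Suc j) x + (- 1 / \<mu>) * e j x"

lemma A_v: "A (v j) \<doteq> (\<lambda>x. e j x + G (1 / \<mu>) (Suc j) 0 / \<mu>)"
proof -
  have "A (v j) \<doteq> (\<lambda>x. (- 1 / \<mu>\<^sup>2) * A (e (Suc j)) x + (- 1 / \<mu>) * A (e j) x)"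
    unfolding v_def[abs_def] by (rule V_shift_comb[OF g_L2 g_L2])
  with A_e_Suc[of j] show ?thesis
  proof eventually_elim
    case (elim x)
    show ?case
      by (subst elim(2), subst elim(1)) (use \<mu> in \<open>simp add: field_simps power2_eq_square\<close>)
  qed
qed

lemma v_in_chain_span: "v j \<in> chain_span (Suc (Suc j))"
  unfolding v_def[abs_def]
  by (rule chain_span_comb[OF e_in_chain_span chain_span_Suc[OF e_in_chain_span]])

lemma v_L2: "v j \<in> L2_01"
  by (rule chain_span_L2[OF v_in_chain_span])

text \<open>Lets a function be corrected by a chain element with the same image below the top level,
  so that only the top coefficient of its image remains to be examined.\<close>

lemma A_surj: "h \<in> chain_span n \<Longrightarrow> n < m \<Longrightarrow> \<exists>w\<in>chain_span (Suc n). A w \<doteq> h"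
proof (induction n arbitrary: h)
  case 0
  have "(\<lambda>x. 0) \<in> chain_span (Suc 0)"
    by (intro chain_span_Suc) (auto simp: chain_span_0_iff intro!: continuous_L2)
  moreover have "A (\<lambda>x. 0) \<doteq> (\<lambda>x. 0)"
    by (rule ae_eqI) (simp add: V_shift_def V_op_def set_lebesgue_integral_def)
  moreover have "h \<doteq> (\<lambda>x. 0)" using 0 by (simp add: chain_span_0_iff)
  ultimately show ?case by (intro bexI[of _ "\<lambda>x. 0"]) (auto elim: eventually_elim2)
next
  case (Suc n)
  obtain c h' where h': "h' \<in> chain_span n" "h \<doteq> (\<lambda>x. 1 * h' x + c * e n x)"
    using chain_span_SucE[OF Suc.prems(1)] by blast
  obtain w where w: "w \<in> chain_span (Suc n)" "A w \<doteq> h'"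
    using Suc.IH[OF h'(1)] Suc.prems(2) by auto
  have "A (\<lambda>x. 1 * w x + c * v n x) \<doteq> (\<lambda>x. 1 * A w x + c * A (v n) x)"
    by (rule V_shift_comb[OF chain_span_L2[OF w(1)] v_L2])
  with w(2) h'(2) A_v[of n] have "A (\<lambda>x. 1 * w x + c * v n x) \<doteq> h"
    by eventually_elim (simp add: zero[OF Suc.prems(2)])
  moreover have "(\<lambda>x. 1 * w x + c * v n x) \<in> chain_span (Suc (Suc n))"
    by (rule chain_span_comb[OF chain_span_Suc[OF w(1)] v_in_chain_span])
  ultimately show ?case by blast
qed

text \<open>With \<open>m = Suc m'\<close>, the correction for the top term \<open>c * e m'\<close>
  is \<open>c * v m'\<close>, whose image is off by a multiple of the nonzero
  \<open>G (1 / \<mu>) m 0\<close>. At a zero of \<open>D\<close>, \<open>resolvent_const\<close>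
  admits no nonzero constant, so \<open>c = 0\<close> and the chain stops at
  \<open>m\<close>.\<close>

lemma A_pow_zero_imp: "f \<in> L2_01 \<Longrightarrow> (A ^^ k) f \<doteq> (\<lambda>x. 0) \<Longrightarrow> f \<in> chain_span m"
proof (induction k arbitrary: f)
  case 0
  have "(\<lambda>x. 0) \<in> chain_span m"
    by (auto simp: chain_span_def intro!: continuous_L2 exI[of _ "\<lambda>_. 0"])
  then show ?case using 0 chain_span_cong by auto
next
  case (Suc k)
  obtain m' where m': "m = Suc m'" using m_pos not0_implies_Suc by blast
  have "(A ^^ k) (A f) \<doteq> (\<lambda>x. 0)" using Suc.prems(2) by (simp add: funpow_swap1)
  then have "A f \<in> chain_span (Suc m')" using Suc.IH V_shift_L2[OF Suc.prems(1)] m' by blast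
  then obtain c h where h: "h \<in> chain_span m'" "A f \<doteq> (\<lambda>x. 1 * h x + c * e m' x)"
    using chain_span_SucE by blast
  obtain w where w: "w \<in> chain_span m" "A w \<doteq> h" using A_surj[OF h(1)] m' by auto
  define u where "u x = 1 * w x + c * v m' x" for x
  have u: "u \<in> L2_01" unfolding u_def[abs_def] by (rule L2_comb[OF chain_span_L2[OF w(1)] v_L2])
  define s where "s x = 1 * f x + (- 1) * u x" for x
  have s: "s \<in> L2_01" unfolding s_def[abs_def] by (rule L2_comb[OF Suc.prems(1) u])
  have "A u \<doteq> (\<lambda>x. 1 * A w x + c * A (v m') x)"
    unfolding u_def[abs_def] by (rule V_shift_comb[OF chain_span_L2[OF w(1)] v_L2])
  moreover have "A s \<doteq> (\<lambda>x. 1 * A f x + (- 1) * A u x)"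
    unfolding s_def[abs_def] by (rule V_shift_comb[OF Suc.prems(1) u])
  ultimately have "A s \<doteq> (\<lambda>x. - c * G (1 / \<mu>) m 0 / \<mu>)"
    using w(2) h(2) A_v[of m'] by eventually_elim (simp add: m' algebra_simps)
  then obtain \<beta> where \<beta>: "s \<doteq> (\<lambda>x. \<beta> * e 0 x)" "\<beta> * D (1 / \<mu>) = - (- c * G (1 / \<mu>) m 0 / \<mu>) / \<mu>"
    using resolvent_const[OF s \<mu>] by blast
  then have c: "c = 0" using \<mu> nonzero by (simp add: D_zero)
  have "e 0 \<in> chain_span m"
  proof -
    have "e 0 \<in> chain_span (Suc n)" for n
      by (induction n) (auto intro: chain_span_Suc e_in_chain_span)
    then show ?thesis unfolding m' .
  qed
  then have "(\<lambda>x. 1 * w x + \<beta> * e 0 x) \<in> chain_span m" by (intro chain_span_comb w)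
  moreover have "f \<doteq> (\<lambda>x. 1 * w x + \<beta> * e 0 x)"
    using \<beta>(1) by eventually_elim (simp add: s_def u_def c algebra_simps)
  ultimately show ?case using chain_span_cong Suc.prems(1) by blast
qed

lemma gen_eigenspace_eq: "gen_eigenspace \<phi> \<mu> = chain_span m"
  using chain_span_subset A_pow_zero_imp unfolding gen_eigenspace_def ae_zero_def by blast

theorem alg_mult_eq: "alg_mult \<phi> \<mu> = enat m"
  unfolding alg_mult_def
proof (rule Sup_eqI)
  fix N assume "N \<in> {enat (card F) |F. finite F \<and> F \<subseteq> gen_eigenspace \<phi> \<mu> \<and> indep_L2 F}"
  then obtain F where F: "finite F" "F \<subseteq> chain_span m" "indep_L2 F" and N: "N = enat (card F)"
    by (auto simp: gen_eigenspace_eq)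
  have "\<forall>f\<in>F. \<exists>a. f \<doteq> (\<lambda>x. \<Sum>i<m. a i * e i x)" using F(2) by (auto simp: chain_span_def)
  then obtain a where a: "\<And>f. f \<in> F \<Longrightarrow> f \<doteq> (\<lambda>x. \<Sum>i<m. a f i * e i x)" by metis
  have "card F \<le> m"
  proof (rule ccontr)
    assume "\<not> card F \<le> m"
    then obtain c where c: "\<exists>f\<in>F. c f \<noteq> 0" "\<And>i. i < m \<Longrightarrow> (\<Sum>f\<in>F. c f * a f i) = 0"
      using nontrivial_solution[OF F(1), of m a] by auto
    \<comment> \<open>Finitely many exceptional null sets are merged, so that the sums can be
      exchanged pointwise.\<close>
    have "AE x in lebesgue_on {0..1}. \<forall>f\<in>F. f x = (\<Sum>i<m. a f i * e i x)"
      using a by (intro AE_finite_allI F(1))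
    then have "(\<lambda>x. \<Sum>f\<in>F. c f * f x) \<doteq> (\<lambda>x. 0)"
    proof eventually_elim
      case (elim x)
      have "(\<Sum>f\<in>F. c f * f x) = (\<Sum>f\<in>F. c f * (\<Sum>i<m. a f i * e i x))"
        by (rule sum.cong[OF refl], drule bspec[OF elim], simp only:)
      also have "\<dots> = (\<Sum>f\<in>F. \<Sum>i<m. c f * a f i * e i x)"
        by (simp add: sum_distrib_left mult.assoc)
      also have "\<dots> = (\<Sum>i<m. (\<Sum>f\<in>F. c f * a f i) * e i x)"
        by (subst sum.swap) (simp add: sum_distrib_right)
      finally show ?case using c(2) by simp
    qed
    then show False using F(3) c(1) unfolding indep_L2_def ae_zero_def by blast
  qed
  then show "N \<le> enat m" using N by simp
next
  fix y assume y: "\<And>N. N \<in> {enat (card F) |F. finite F \<and> F \<subseteq> gen_eigenspace \<phi> \<mu> \<and> indep_L2 F} \<Longrightarrow> N \<le> y"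
  have in_span: "e i \<in> chain_span n" if "i < n" for i n
    using that
  proof (induction n)
    case (Suc n)
    then show ?case by (cases "i = n") (auto intro: e_in_chain_span chain_span_Suc)
  qed simp
  \<comment> \<open>\<open>alg_mult\<close> counts sets, so the chain must consist of
    \<open>m\<close> distinct functions.\<close>
  have inj: "inj_on e {..<m}"
  proof (rule inj_onI, rule ccontr)
    fix i j assume ij: "i \<in> {..<m}" "j \<in> {..<m}" "e i = e j" "i \<noteq> j"
    define c where "c k = (if k = i then 1 else if k = j then - 1 else (0::complex))" for k
    have "(\<Sum>k<m. c k * e k x) = 0" for x
    proof -
      have "(\<Sum>k<m. c k * e k x) = (\<Sum>k\<in>{i, j}. c k * e k x)"
        by (rule sum.mono_neutral_right) (use ij in \<open>auto simp: c_def\<close>)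
      then show ?thesis using ij by (simp add: c_def)
    qed
    then have "c i = 0" using e_indep[of c m i] ij by simp
    then show False by (simp add: c_def)
  qed
  have "indep_L2 (e ` {..<m})"
    unfolding indep_L2_def ae_zero_def
  proof (intro allI impI ballI)
    fix c f assume 0: "AE x in lebesgue_on {0..1}. (\<Sum>f\<in>e ` {..<m}. c f * f x) = 0" and "f \<in> e ` {..<m}"
    then obtain i where i: "i < m" "f = e i" by auto
    have "(\<lambda>x. \<Sum>i<m. c (e i) * e i x) \<doteq> (\<lambda>x. 0)" using 0 by (simp add: sum.reindex[OF inj])
    then show "c f = 0" using e_indep[of "\<lambda>i. c (e i)" m] i by blast
  qed
  then have "enat (card (e ` {..<m})) \<le> y"
    using in_span by (intro y) (auto simp: gen_eigenspace_eq)
  then show "enat m \<le> y" by (simp add: card_image[OF inj])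
qed

end

section \<open>From zeros of the determinant to eigenvalues\<close>

lemma (in volterra_composition) finite_zeros_D:
  assumes "\<And>n. n > N \<Longrightarrow> P n 0 = 0"
  shows "finite {w. D w = 0}"
proof -
  have "D w = (\<Sum>i\<le>N. ((-1) ^ i * complex_of_real (P i 0)) * w ^ i)" for w
  proof -
    have "D w = (\<Sum>n\<le>N. P n 0 *\<^sub>R taylor_coeff w 0 n)"
      unfolding D_def G_def S_def by (rule suminf_finite) (auto simp: assms)
    then show ?thesis by (simp add: taylor_coeff_def scaleR_conv_of_real mult_ac)
  qed
  moreover have "finite {w. (\<Sum>i\<le>N. ((-1) ^ i * complex_of_real (P i 0)) * w ^ i) = 0}"
    \<comment> \<open>The coefficient of index 0 is \<open>P 0 0 = 1\<close>, so the polynomial is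
      not zero.\<close>
    by (subst polyfun_finite_roots) (auto intro!: exI[of _ 0])
  ultimately show ?thesis by simp
qed

theorem theorem1p1:
  fixes \<phi> :: "real \<Rightarrow> real" and \<omega> :: enat and lam :: "nat \<Rightarrow> complex"
  assumes range: "\<forall>x\<in>{0..1}. \<phi> x \<in> {0..1}"
    and mono: "mono_on {0..1} \<phi>"
    and cont: "continuous_on {0..1} \<phi>"
    and above: "\<forall>x\<in>{0<..<1}. \<phi> x > x"
    and enum: "enumerates_eigs \<phi> \<omega> lam"
  shows "(\<omega> < \<infinity> \<longleftrightarrow> \<phi> 0 > 0 \<and> (\<exists>\<epsilon>\<in>{0<..<1}. \<phi> (1 - \<epsilon>) = 1)) \<and>
         ((\<lambda>\<epsilon>. \<Sum>n\<in>{n. enat n < \<omega> \<and> cmod (lam n) > \<epsilon>}. lam n) \<longlongrightarrow> 1) (at_right 0) \<and>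
         (\<forall>\<epsilon>>0. (\<lambda>n. cmod (lam n) powr (1 + \<epsilon>)) summable_on {n. enat n < \<omega>})"
proof -
  interpret volterra_composition \<phi>
    using range mono cont above by unfold_locales
  define I where "I = {n. enat n < \<omega>}"
  define z where "z n = 1 / lam n" for n
  have lam: "lam n \<noteq> 0" "eigenvalue \<phi> (lam n)" if "n \<in> I" for n
    using enum that unfolding enumerates_eigs_def I_def by auto
  \<comment> \<open>The order of the zero is the algebraic multiplicity, and the enumeration repeats
    the eigenvalue that often; a finite multiplicity also excludes an infinite fibre.\<close>
  have fibre: "has_zero_order D a (card {n\<in>I. z n = a}) \<and> finite {n\<in>I. z n = a}" if a: "D a = 0" for a
  proof -
    have a0: "a \<noteq> 0" using a D_0 by auto
    obtain k where k: "has_zero_order D a k" "(deriv ^^ k) D a \<noteq> 0" "\<And>j. j < k \<Longrightarrow> (deriv ^^ j) D a = 0"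
      using has_zero_order_exists[OF holomorphic_D, of 0 a] D_0 by auto
    define \<mu> where "\<mu> = 1 / a"
    have inv: "\<mu> \<noteq> 0" "1 / \<mu> = a" using a0 by (auto simp: \<mu>_def)
    have k0: "k > 0" using k(2) a by (cases k) auto
    interpret volterra_eigenvalue \<phi> \<mu> k
    proof
      show "G (1 / \<mu>) j 0 = 0" if "j < k" for j
        using k(3)[OF that] unfolding higher_deriv_D inv(2) by simp
      show "G (1 / \<mu>) k 0 \<noteq> 0"
        using k(2) unfolding higher_deriv_D inv(2) by simp
    qed (rule inv(1) k0)+
    have "eigenvalue \<phi> \<mu>" unfolding eigenvalue_iff[OF inv(1)] inv(2) by (rule a)
    then have "enat k = (let S = {n. enat n < \<omega> \<and> lam n = \<mu>} in if finite S then enat (card S) else \<infinity>)"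
      using enum inv(1) unfolding enumerates_eigs_def alg_mult_eq[symmetric] by blast
    moreover have "{n. enat n < \<omega> \<and> lam n = \<mu>} = {n\<in>I. z n = a}"
      using lam(1) a0 by (auto simp: I_def z_def \<mu>_def field_simps)
    ultimately have "finite {n\<in>I. z n = a}" "card {n\<in>I. z n = a} = k"
      by (auto simp: Let_def split: if_splits)
    then show ?thesis using k(1) by simp
  qed
  interpret minimal_type D I z
  proof
    show "D (z n) = 0" if "n \<in> I" for n
      using lam[OF that] eigenvalue_iff[of "lam n"] by (simp add: z_def)
  qed (use fibre in \<open>auto intro: holomorphic_D D_0 D_growth\<close>)
  have I_iff: "\<omega> < \<infinity> \<longleftrightarrow> finite I"
    unfolding I_def by (cases \<omega>) auto
  have "finite I \<longleftrightarrow> (\<exists>N. \<forall>n>N. P n 0 = 0)"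
  proof
    assume "finite I"
    then obtain N where N: "\<And>k. k > N \<Longrightarrow> (deriv ^^ k) D 0 = 0" using finite_zeros_imp_polynomial by blast
    have "P n 0 = 0" if "n > N" for n using N[OF that] unfolding higher_deriv_D_0 by simp
    then show "\<exists>N. \<forall>n>N. P n 0 = 0" by blast
  next
    assume "\<exists>N. \<forall>n>N. P n 0 = 0"
    then have "finite {w. D w = 0}" using finite_zeros_D by blast
    moreover have "I \<subseteq> (\<Union>a\<in>{w. D w = 0}. {n\<in>I. z n = a})" using zero by auto
    ultimately show "finite I" using finite_fibre by (auto intro: finite_subset)
  qed
  then have 1: "\<omega> < \<infinity> \<longleftrightarrow> \<phi> 0 > 0 \<and> (\<exists>\<epsilon>\<in>{0<..<1}. \<phi> (1 - \<epsilon>) = 1)"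
    unfolding I_iff P_eventually_0_iff .
  \<comment> \<open>The radius is \<open>R = 1 / \<epsilon>\<close>; for
    \<open>\<epsilon> > 0\<close>, the strict inequality for \<open>z n\<close> matches the strict
    one for \<open>lam n\<close>.\<close>
  have "((\<lambda>\<epsilon>. \<Sum>n\<in>{n\<in>I. cmod (z n) < inverse \<epsilon>}. 1 / z n) \<longlongrightarrow> 1) (at_right 0)"
    using filterlim_compose[OF sum_inverse_zeros filterlim_inverse_at_top_right] by (simp add: deriv_D_0)
  moreover have "\<forall>\<^sub>F \<epsilon> in at_right 0. (\<Sum>n\<in>{n\<in>I. cmod (z n) < inverse \<epsilon>}. 1 / z n)
      = (\<Sum>n\<in>{n. enat n < \<omega> \<and> cmod (lam n) > \<epsilon>}. lam n)"
    using eventually_at_right_less[of 0]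
  proof eventually_elim
    case (elim \<epsilon>)
    have "{n\<in>I. cmod (z n) < inverse \<epsilon>} = {n. enat n < \<omega> \<and> cmod (lam n) > \<epsilon>}"
      using lam(1) elim by (auto simp: I_def z_def norm_divide field_simps)
    then show ?case by (simp add: z_def)
  qed
  ultimately have 2: "((\<lambda>\<epsilon>. \<Sum>n\<in>{n. enat n < \<omega> \<and> cmod (lam n) > \<epsilon>}. lam n) \<longlongrightarrow> 1) (at_right 0)"
    by (rule Lim_transform_eventually)
  have 3: "\<forall>\<epsilon>>0. (\<lambda>n. cmod (lam n) powr (1 + \<epsilon>)) summable_on {n. enat n < \<omega>}"
    using summable_inverse_zeros by (simp add: z_def norm_divide I_def)
  from 1 2 3 show ?thesis by blast
qed

end
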